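(* Let $\tau\in\mathbb{C}$ with $\mathrm{Im}(\tau)>0$, $q=e^{2\pi i\tau}$, $u,v\in\mathbb{C}$ with $u,v\notin\mathbb{Z}+\mathbb{Z}\tau$, and let $$S(r)=\sum_{k=0}^\infty\mu(u,v;k+1)\,r^k .$$ The following identities hold (for all $r\in\mathbb{C}$ for which the series occurring converge). (1) $S(r)$ satisfies the $q$-difference equations $$S(r)=\big(1-re^{\pi i(u-v)}q\big)\big(1-re^{-\pi i(u-v)}q\big)S(rq)-i\,r\,q^{\frac78},$$ $$\Big[\big(1-re^{\pi i(u-v)}q^2\big)\big(1-re^{-\pi i(u-v)}q^2\big)T_r^2-\Big(1+q\big(1-re^{\pi i(u-v)}q\big)\big(1-re^{-\pi i(u-v)}q\big)\Big)T_r+q\Big]S(r)=0.$$ (2) $S(r)$ has the closed forms $$S(r)=\big(re^{\pi i(u-v)}q,re^{-\pi i(u-v)}q\big)_\infty\,\mu(u,v)-i\,r\,q^{\frac78}\;{}_3\phi_2\left(\begin{matrix} q,re^{\pi i(u-v)}q,re^{-\pi i(u-v)}q \\ 0,0 \end{matrix};q,q\right),$$ and, for $|re^{\pm\pi i(u-v)}q|<1$, $$S(r)=\big(re^{\pi i(u-v)}q,re^{-\pi i(u-v)}q\big)_\infty\left\{\mu(u,v)-\frac{i\,r\,q^{\frac78}}{1-q}\Phi^{(1)}\left(\begin{matrix} q;0,0 \\ q^2 \end{matrix};q;re^{\pi i(u-v)}q,re^{-\pi i(u-v)}q\right)\right\}$$ $$=\big(re^{\pi i(u-v)}q,re^{-\pi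 i(u-v)}q\big)_\infty\sum_{m\ge0}\frac{\mu(u,v;1-m)}{(q)_m}q^mr^m.$$
   Context: Powers: $q^s:=e^{2\pi is\tau}$. $T_rf(r)=f(qr)$. $(x)_\infty=(x;q)_\infty=\prod_{j\ge0}(1-xq^j)$, $(x)_n=(x)_\infty/(q^nx)_\infty$ (so $(0)_n=1$), $(x,y)_\infty=(x)_\infty(y)_\infty$. $\vartheta_{11}(u)=\sum_{n\in\mathbb{Z}}e^{2\pi i(n+\frac12)(u+\frac12)+\pi i(n+\frac12)^2\tau}$. ${}_3\phi_2\left(\begin{matrix} A,B,C \\ 0,0 \end{matrix};q,x\right)=\sum_{n\ge0}\frac{(A)_n(B)_n(C)_n}{(q)_n}x^n$. $q$-Appell function: $\Phi^{(1)}\left(\begin{matrix} a;b_1,b_2 \\ c \end{matrix};q;x,y\right)=\sum_{m,n\ge0}\frac{(a)_{m+n}(b_1)_m(b_2)_n}{(c)_{m+n}(q)_m(q)_n}x^my^n$. Generalized $\mu$-function: for $\alpha,u,v\in\mathbb{C}$ with $u-\alpha\tau,v\notin\mathbb{Z}+\mathbb{Z}\tau$, $$\mu(u,v;\alpha)=\frac{e^{\pi i\alpha(u-v)}}{\vartheta_{11}(v)}\sum_{n\in\mathbb{Z}}(-1)^ne^{2\pi i(n+\frac12)v}q^{\frac{n(n+1)}2}\frac{(e^{2\pi iu}q^{n+1})_\infty}{(e^{2\pi iu}q^{n-\alpha+1})_\infty},$$ and $\mu(u,v)=\mu(u,v;1)$ is Zwegers' $\mu$-function. *)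

theory Defs
  imports "HOL-Analysis.Analysis"
begin

text \<open>The power \<open>q\<^sup>s\<close> for complex \<open>s\<close>, with the branch fixed by \<open>\<tau>\<close>: \<open>q\<^sup>s = exp (2 \<pi> \<i> s \<tau>)\<close>.\<close>

definition qpow :: "complex \<Rightarrow> complex \<Rightarrow> complex" where
  "qpow \<tau> s = exp (2 * of_real pi * \<i> * s * \<tau>)"

definition lattice :: "complex \<Rightarrow> complex set" where
  "lattice \<tau> = {of_int m + of_int n * \<tau> | m n. True}"

definition qpoch_inf :: "complex \<Rightarrow> complex \<Rightarrow> complex" where
  "qpoch_inf q x = (\<Prod>j. 1 - x * q ^ j)"

text \<open>The finite \<open>q\<close>-shifted factorial \<open>(x)\<^sub>n\<close> is \<open>(x)\<^sub>\<infinity> / (q\<^sup>n x)\<^sub>\<infinity>\<close>. When \<open>x = q\<^sup>-\<^sup>k\<close> with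
  \<open>k \<ge> n\<close>, this quotient is \<open>0/0\<close> and has to be read as the finite product to which it extends
  continuously, so the finite product is taken as the definition; \<open>qpoch_eq_quotient\<close> below is
  the quotient formula.\<close>

definition qpoch :: "complex \<Rightarrow> complex \<Rightarrow> nat \<Rightarrow> complex" where
  "qpoch q x n = (\<Prod>j<n. 1 - x * q ^ j)"

lemma convergent_prod_qpoch:
  fixes q x :: complex
  assumes "norm q < 1"
  shows "convergent_prod (\<lambda>j. 1 - x * q ^ j)"
proof -
  have "summable (\<lambda>j. norm x * norm q ^ j)"
    using assms by (intro summable_mult summable_geometric) auto
  hence "abs_convergent_prod (\<lambda>j. 1 - x * q ^ j)"
    by (simp add: abs_convergent_prod_conv_summable norm_mult norm_power)
  thus ?thesis
    by (rule abs_convergent_prod_imp_convergent_prod)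
qed

lemma qpoch_inf_split:
  assumes "norm q < 1"
  shows "qpoch_inf q x = qpoch q x n * qpoch_inf q (q ^ n * x)"
  using has_prod_unique[OF has_prod_ignore_initial_segment'[OF convergent_prod_qpoch[OF assms, of x], of n]]
  by (simp add: qpoch_inf_def qpoch_def power_add mult_ac)

lemma qpoch_eq_quotient:
  assumes "norm q < 1" and "qpoch_inf q (q ^ n * x) \<noteq> 0"
  shows "qpoch q x n = qpoch_inf q x / qpoch_inf q (q ^ n * x)"
  using qpoch_inf_split[OF assms(1), of x n] assms(2) by simp

definition theta11 :: "complex \<Rightarrow> complex \<Rightarrow> complex" where
  "theta11 \<tau> u = (\<Sum>\<^sub>\<infinity>n::int.
     exp (2 * of_real pi * \<i> * (of_int n + 1/2) * (u + 1/2)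
          + of_real pi * \<i> * (of_int n + 1/2)\<^sup>2 * \<tau>))"

text \<open>The generalized \<open>\<mu>\<close>-function, meaningful for \<open>u - \<alpha> \<tau>\<close> and \<open>v\<close> outside the lattice.
  Zwegers' \<open>\<mu>(u,v)\<close> is the case \<open>\<alpha> = 1\<close>.\<close>

definition gen_mu :: "complex \<Rightarrow> complex \<Rightarrow> complex \<Rightarrow> complex \<Rightarrow> complex" where
  "gen_mu \<tau> u v \<alpha> =
     exp (of_real pi * \<i> * \<alpha> * (u - v)) / theta11 \<tau> v *
     (\<Sum>\<^sub>\<infinity>n::int.
        (-1) powi n * exp (2 * of_real pi * \<i> * (of_int n + 1/2) * v)
        * qpow \<tau> (of_int n * (of_int n + 1) / 2)
        * (qpoch_inf (qpow \<tau> 1) (exp (2 * of_real pi * \<i> * u) * qpow \<tau> (of_int n + 1))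
           / qpoch_inf (qpow \<tau> 1) (exp (2 * of_real pi * \<i> * u) * qpow \<tau> (of_int n - \<alpha> + 1))))"

abbreviation zwegers_mu :: "complex \<Rightarrow> complex \<Rightarrow> complex \<Rightarrow> complex" where
  "zwegers_mu \<tau> u v \<equiv> gen_mu \<tau> u v 1"

definition phi32 ::
  "complex \<Rightarrow> complex \<Rightarrow> complex \<Rightarrow> complex \<Rightarrow> complex \<Rightarrow> complex \<Rightarrow> complex \<Rightarrow> complex" where
  "phi32 A B C D E q x =
     (\<Sum>n. qpoch q A n * qpoch q B n * qpoch q C n
           / (qpoch q q n * qpoch q D n * qpoch q E n) * x ^ n)"

definition q_appell1 ::
  "complex \<Rightarrow> complex \<Rightarrow> complex \<Rightarrow> complex \<Rightarrow> complex \<Rightarrow> complex \<Rightarrow> complex \<Rightarrow> complex" where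
  "q_appell1 a b1 b2 c q x y =
     (\<Sum>\<^sub>\<infinity>(m::nat, n::nat).
        qpoch q a (m + n) * qpoch q b1 m * qpoch q b2 n
        / (qpoch q c (m + n) * qpoch q q m * qpoch q q n) * x ^ m * y ^ n)"

text \<open>The operator \<open>T\<^sub>r\<close> on functions of \<open>r\<close>.\<close>

definition q_shift :: "complex \<Rightarrow> (complex \<Rightarrow> complex) \<Rightarrow> complex \<Rightarrow> complex" where
  "q_shift q f = (\<lambda>r. f (q * r))"

definition mu_series_term :: "complex \<Rightarrow> complex \<Rightarrow> complex \<Rightarrow> complex \<Rightarrow> nat \<Rightarrow> complex" where
  "mu_series_term \<tau> u v r k = gen_mu \<tau> u v (of_nat k + 1) * r ^ k"

definition mu_series :: "complex \<Rightarrow> complex \<Rightarrow> complex \<Rightarrow> complex \<Rightarrow> complex" where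
  "mu_series \<tau> u v r = (\<Sum>k. mu_series_term \<tau> u v r k)"

end

theory Submission
  imports Defs
begin

text \<open>
  Everything follows from one contiguous relation. Put \<open>X = e\<^bsup>\<pi>i(u-v)\<^esup>\<close>, \<open>Y = 1/X\<close>. Comparing terms of
  the bilateral series at parameters \<open>\<alpha>\<close> and \<open>\<alpha> - 1\<close>, once with equal and once with shifted index,
  gives (\<open>gen_mu_recurrence\<close>)
  \<open>(q\<^bsup>1-\<alpha>\<^esup> - 1) \<mu>(\<alpha>) = \<mu>(\<alpha> - 2) - (X + Y) \<mu>(\<alpha> - 1)\<close>.
  Besides this only the value \<open>\<mu>(0) = - i q\<^bsup>-1/8\<^esup>\<close> is needed (\<open>gen_mu_0\<close>). At \<open>\<alpha> = 0\<close> the series is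
  \<open>\<theta>\<^sub>1\<^sub>1(v)\<close> up to a constant factor, so that value rests on \<open>\<theta>\<^sub>1\<^sub>1(v) \<noteq> 0\<close> off the lattice, which comes from
  the Jacobi triple product (\<open>jacobi_triple_product\<close>, \<open>theta_nonzero\<close>).

  For \<open>\<alpha> = 2, 3, \<dots>\<close> the relation is a three-term recurrence for the coefficients of \<open>S\<close>. Since
  the factor \<open>1 - q\<^sup>k\<close> on coefficients is a \<open>q\<close>-difference of functions, it is equivalent to
  \<open>S(r) = (1 - r X q) (1 - r Y q) S(r q) + \<mu>(0) q r\<close>, which is the first equation
  (\<open>three_term_series_q_difference\<close>). Subtracting \<open>q\<close> times it from its dilate gives the second.
  Iterating it into the origin, where \<open>S\<close> is continuous with value \<open>\<mu>(1)\<close>, gives the \<open>\<^sub>3\<phi>\<^sub>2\<close> form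
  (\<open>three_term_series_phi32\<close>).

  For \<open>\<alpha> = 1, 0, -1, \<dots>\<close> the same relation is the recurrence of the Rogers-Szego polynomials
  \<open>H\<^sub>m(X, Y)\<close>, whence \<open>\<mu>(-m) = \<mu>(0) H\<^sub>m(X, Y)\<close>. By Euler's expansion their generating function
  \<open>\<Sum>\<^sub>m H\<^sub>m x\<^sup>m / (q)\<^sub>m\<close> is \<open>1 / (xX, xY)\<^sub>\<infinity>\<close> (\<open>rs_generating_function\<close>), and the \<open>q\<close>-Appell function is the same
  series with the weights \<open>(1 - q) / (1 - q\<^bsup>m+1\<^esup>)\<close>, which invert a \<open>q\<close>-difference
  (\<open>q_appell1_sums\<close>). So the two expressions in braces coincide, and their \<open>q\<close>-difference is that of
  \<open>S\<close> divided by the infinite product; equality follows by going to the origin again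
  (\<open>three_term_series_product_form\<close>).
\<close>

section \<open>q-Pochhammer symbols and dilations of power series\<close>

lemma qpoch_inf_step:
  assumes "norm q < 1"
  shows "qpoch_inf q x = (1 - x) * qpoch_inf q (x * q)"
  using qpoch_inf_split[OF assms, of x 1] by (simp add: qpoch_def mult.commute)

lemma qpoch_0 [simp]: "qpoch q x 0 = 1" and qpoch_zero [simp]: "qpoch q 0 n = 1"
  by (simp_all add: qpoch_def)

lemma qpoch_Suc: "qpoch q x (Suc n) = qpoch q x n * (1 - x * q ^ n)"
  by (simp add: qpoch_def)

lemma qpoch_inf_nonzero:
  assumes "norm q < 1" "\<And>j. x * q ^ j \<noteq> 1"
  shows "qpoch_inf q x \<noteq> 0"
  unfolding qpoch_inf_def
  by (rule prodinf_nonzero[OF convergent_prod_qpoch[OF assms(1)]]) (use assms(2) in \<open>metis eq_iff_diff_eq_0\<close>)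

lemma qpoch_inf_eq_0:
  assumes "norm q < 1" "x * q ^ j = 1"
  shows "qpoch_inf q x = 0"
  using assms(2) by (subst qpoch_inf_split[OF assms(1), of _ "Suc j"]) (simp add: qpoch_Suc)

lemma norm_mult_power_less_1:
  fixes x q :: complex
  assumes "norm q < 1" "norm x < 1"
  shows "norm (x * q ^ j) < 1"
proof -
  have "norm (x * q ^ j) \<le> norm x * 1"
    unfolding norm_mult norm_power using assms by (intro mult_left_mono power_le_one) auto
  thus ?thesis using assms by simp
qed

lemma qpoch_inf_nonzero_disc:
  assumes "norm q < 1" "norm x < 1"
  shows "qpoch_inf q x \<noteq> 0"
  using norm_mult_power_less_1[OF assms] by (intro qpoch_inf_nonzero assms(1)) (metis norm_one order_less_irrefl)

lemma qpoch_nonzero: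
  assumes "norm q < 1"
  shows "qpoch q q n \<noteq> 0"
  using qpoch_inf_nonzero_disc[OF assms assms] qpoch_inf_split[OF assms, of q n] by auto

lemma one_minus_power_nonzero:
  fixes q :: complex
  assumes "norm q < 1"
  shows "1 - q ^ Suc n \<noteq> 0"
  using norm_mult_power_less_1[OF assms assms, of n] by auto

lemma qpoch_tendsto:
  assumes "norm q < 1"
  shows "(\<lambda>n. qpoch q x n) \<longlonglongrightarrow> qpoch_inf q x"
  using convergent_prod_LIMSEQ[OF convergent_prod_qpoch[OF assms, of x]]
  by (simp add: qpoch_def qpoch_inf_def LIMSEQ_lessThan_iff_atMost)

lemma power_tendsto_0:
  fixes q x :: complex
  assumes "norm q < 1"
  shows "(\<lambda>n. x * q ^ n) \<longlonglongrightarrow> 0"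
  using tendsto_mult_right[OF LIMSEQ_power_zero[OF assms], of x]
  by (simp add: mult.commute)

lemma powser_summable_mult_q:
  fixes c :: "nat \<Rightarrow> complex"
  assumes "norm q < 1" "summable (\<lambda>k. c k * x ^ k)"
  shows "summable (\<lambda>k. c k * (x * q) ^ k)"
proof (cases "x = 0")
  case False
  hence "norm (x * q) < norm x" using assms(1) by (simp add: norm_mult)
  with assms(2) show ?thesis by (rule powser_inside)
qed (use assms in simp)

text \<open>Every uniqueness argument below follows an identity along the orbit \<open>x, x q, x q\<^sup>2, \<dots>\<close>
  into the origin; the limit there picks out the constant coefficient.\<close>
lemma powser_mult_q_tendsto:
  fixes c :: "nat \<Rightarrow> complex"
  assumes "norm q < 1" "summable (\<lambda>k. c k * x ^ k)"
  shows "(\<lambda>n. \<Sum>k. c k * (x * q ^ n) ^ k) \<longlonglongrightarrow> c 0"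
proof (cases "x = 0")
  case True
  have "(\<Sum>k. c k * 0 ^ k) = c 0" by simp
  with True show ?thesis by simp
next
  case False
  have "isCont (\<lambda>y. \<Sum>k. c k * y ^ k) 0"
    by (rule isCont_powser[OF assms(2)]) (use False in simp)
  from isCont_tendsto_compose[OF this power_tendsto_0[OF assms(1)]] show ?thesis by simp
qed

text \<open>The multiplier \<open>1 - q\<^sup>k\<close> on coefficients is the operator \<open>1 - T\<close> with \<open>T\<close> the dilation by
  \<open>q\<close>. This turns recurrences whose leading factor is \<open>1 - q\<^sup>k\<close> into \<open>q\<close>-difference equations.\<close>
lemma powser_q_difference:
  fixes c :: "nat \<Rightarrow> complex"
  assumes "norm q < 1" "summable (\<lambda>k. c k * x ^ k)"
  shows "(\<Sum>k. c k * x ^ k) - (\<Sum>k. c k * (x * q) ^ k)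
           = x * (\<Sum>k. c (Suc k) * (1 - q ^ Suc k) * x ^ k)"
proof -
  have s: "summable (\<lambda>k. c k * x ^ k - c k * (x * q) ^ k)"
    using assms powser_summable_mult_q by (intro summable_diff) auto
  have "(\<Sum>k. c k * x ^ k) - (\<Sum>k. c k * (x * q) ^ k) = (\<Sum>k. c k * x ^ k - c k * (x * q) ^ k)"
    using assms powser_summable_mult_q by (intro suminf_diff) auto
  also have "\<dots> = (\<Sum>k. c (Suc k) * x ^ Suc k - c (Suc k) * (x * q) ^ Suc k)"
    using suminf_split_head[OF s] by simp
  also have "\<dots> = (\<Sum>k. x * (c (Suc k) * (1 - q ^ Suc k) * x ^ k))"
    by (simp add: algebra_simps power_mult_distrib)
  also have "\<dots> = x * (\<Sum>k. c (Suc k) * (1 - q ^ Suc k) * x ^ k)"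
  proof (cases "x = 0")
    case False
    have "summable (\<lambda>k. x * (c (Suc k) * (1 - q ^ Suc k) * x ^ k))"
      using s[THEN summable_Suc_iff[THEN iffD2]] by (simp add: algebra_simps power_mult_distrib)
    with False have "summable (\<lambda>k. c (Suc k) * (1 - q ^ Suc k) * x ^ k)"
      by (simp add: summable_cmult_iff)
    thus ?thesis by (rule suminf_mult)
  qed simp
  finally show ?thesis .
qed

section \<open>Euler's two expansions\<close>

lemma summable_norm_ratio_tendsto:
  fixes f :: "nat \<Rightarrow> complex"
  assumes "\<forall>\<^sub>F n in sequentially. f (Suc n) = \<rho> n * f n" "\<rho> \<longlonglongrightarrow> l" "norm l < 1"
  shows "summable (\<lambda>n. norm (f n))"
proof -
  obtain c where c: "norm l < c" "c < 1" using dense[OF assms(3)] by blast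
  have "\<forall>\<^sub>F n in sequentially. norm (\<rho> n) < c"
    by (rule order_tendstoD(2)[OF tendsto_norm[OF assms(2)] c(1)])
  with assms(1) have "\<forall>\<^sub>F n in sequentially. norm (f (Suc n)) \<le> c * norm (f n)"
    by eventually_elim (simp add: norm_mult mult_right_mono)
  then obtain N where "\<And>n. n \<ge> N \<Longrightarrow> norm (f (Suc n)) \<le> c * norm (f n)"
    by (auto simp: eventually_sequentially)
  thus ?thesis by (intro summable_ratio_test[OF c(2)]) auto
qed

lemma euler_inverse_summable:
  assumes "norm q < 1" "norm x < 1"
  shows "summable (\<lambda>n. norm (1 / qpoch q q n * x ^ n))"
proof (rule summable_norm_ratio_tendsto)
  show "\<forall>\<^sub>F n in sequentially. 1 / qpoch q q (Suc n) * x ^ Suc n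
          = x / (1 - q * q ^ n) * (1 / qpoch q q n * x ^ n)"
    by (simp add: qpoch_Suc field_simps)
  show "(\<lambda>n. x / (1 - q * q ^ n)) \<longlonglongrightarrow> x / (1 - 0)"
    by (intro tendsto_intros power_tendsto_0 assms) auto
qed (use assms in simp)

text \<open>The series \<open>e\<close> satisfies \<open>e (x q) = (1 - x) e x\<close>, so \<open>e (x q\<^sup>n) = (x)\<^sub>n e x\<close>, and the left
  side tends to \<open>1\<close>.\<close>
lemma euler_inverse:
  assumes "norm q < 1" "norm x < 1"
  shows "(\<Sum>n. 1 / qpoch q q n * x ^ n) = 1 / qpoch_inf q x"
proof -
  define e where "e y = (\<Sum>n. 1 / qpoch q q n * y ^ n)" for y
  have step: "e (y * q) = (1 - y) * e y" if "norm y < 1" for y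
  proof -
    have "1 / qpoch q q (Suc k) * (1 - q ^ Suc k) = 1 / qpoch q q k" for k
      using one_minus_power_nonzero[OF assms(1), of k] by (simp add: qpoch_Suc)
    hence "e y - e (y * q) = y * e y"
      using powser_q_difference[OF assms(1) summable_norm_cancel[OF euler_inverse_summable[OF assms(1) that]]]
      by (simp only: e_def)
    thus ?thesis by (simp add: algebra_simps)
  qed
  have "e (x * q ^ n) = qpoch q x n * e x" for n
  proof (induction n)
    case (Suc n)
    thus ?case using step[OF norm_mult_power_less_1[OF assms]] by (simp add: qpoch_Suc mult_ac)
  qed simp
  moreover have "(\<lambda>n. e (x * q ^ n)) \<longlonglongrightarrow> 1"
    using powser_mult_q_tendsto[OF assms(1) summable_norm_cancel[OF euler_inverse_summable[OF assms]]]
    by (simp add: e_def)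
  ultimately have "1 = qpoch_inf q x * e x"
    using tendsto_mult_right[OF qpoch_tendsto[OF assms(1), of x], of "e x"]
    by (auto intro: LIMSEQ_unique)
  thus ?thesis by (metis e_def nonzero_mult_div_cancel_left one_neq_zero mult_eq_0_iff)
qed

text \<open>Coefficient of \<open>x\<^sup>n\<close> in Euler's expansion of \<open>(x)\<^sub>\<infinity>\<close>; in the exponent, natural-number subtraction
  at \<open>n = 0\<close> gives \<open>0\<close>.\<close>
definition euler_coeff :: "complex \<Rightarrow> nat \<Rightarrow> complex" where
  "euler_coeff q n = (-1) ^ n * q ^ (n * (n - 1) div 2) / qpoch q q n"

lemma triangular_Suc: "Suc n * (Suc n - 1) div 2 = n * (n - 1) div 2 + n"
proof -
  have "Suc n * (Suc n - 1) = n * (n - 1) + 2 * n" by (cases n) auto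
  thus ?thesis by simp
qed

lemma euler_coeff_Suc:
  assumes "norm q < 1"
  shows "euler_coeff q (Suc n) = - (q ^ n / (1 - q ^ Suc n)) * euler_coeff q n"
  unfolding euler_coeff_def triangular_Suc by (simp add: qpoch_Suc power_add mult_ac)

lemma euler_product_summable:
  assumes "norm q < 1"
  shows "summable (\<lambda>n. norm (euler_coeff q n * x ^ n))"
proof (rule summable_norm_ratio_tendsto)
  show "\<forall>\<^sub>F n in sequentially. euler_coeff q (Suc n) * x ^ Suc n
          = (- x * q ^ n / (1 - q * q ^ n)) * (euler_coeff q n * x ^ n)"
    by (simp add: euler_coeff_Suc[OF assms])
  show "(\<lambda>n. - x * q ^ n / (1 - q * q ^ n)) \<longlonglongrightarrow> 0 / (1 - 0)"
    by (intro tendsto_intros power_tendsto_0 assms) auto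
qed simp

text \<open>Same orbit argument with the functional equation reversed: \<open>E x = (1 - x) E (x q)\<close>.\<close>
lemma euler_product:
  assumes "norm q < 1"
  shows "(\<Sum>n. euler_coeff q n * x ^ n) = qpoch_inf q x"
proof -
  define E where "E y = (\<Sum>n. euler_coeff q n * y ^ n)" for y
  note sm = summable_norm_cancel[OF euler_product_summable[OF assms]]
  have step: "E y = (1 - y) * E (y * q)" for y
  proof -
    have "euler_coeff q (Suc k) * (1 - q ^ Suc k) * y ^ k = - (euler_coeff q k * (y * q) ^ k)" for k
      using one_minus_power_nonzero[OF assms, of k]
      by (simp add: euler_coeff_Suc[OF assms] power_mult_distrib)
    hence "E y - E (y * q) = y * (\<Sum>k. - (euler_coeff q k * (y * q) ^ k))"
      using powser_q_difference[OF assms sm, of y] by (simp only: E_def)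
    also have "\<dots> = - y * E (y * q)"
      using suminf_minus[OF sm, of "y * q"] by (simp add: E_def)
    finally show ?thesis by (simp add: algebra_simps)
  qed
  have "E x = qpoch q x n * E (x * q ^ n)" for n
  proof (induction n)
    case (Suc n)
    thus ?case using step[of "x * q ^ n"] by (simp add: qpoch_Suc mult_ac)
  qed simp
  moreover have "(\<lambda>n. E (x * q ^ n)) \<longlonglongrightarrow> 1"
    using powser_mult_q_tendsto[OF assms sm, of x] by (simp add: E_def euler_coeff_def)
  hence "(\<lambda>n. qpoch q x n * E (x * q ^ n)) \<longlonglongrightarrow> qpoch_inf q x * 1"
    by (intro tendsto_mult qpoch_tendsto assms)
  ultimately have "(\<lambda>n. E x) \<longlonglongrightarrow> qpoch_inf q x" by simp
  thus ?thesis by (simp add: E_def LIMSEQ_const_iff)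
qed

section \<open>Bilateral series and the zeros of the theta function\<close>

lemma has_sum_times_product:
  fixes f :: "'a \<Rightarrow> complex" and g :: "'b \<Rightarrow> complex"
  assumes "f summable_on A" "g summable_on B"
  shows "((\<lambda>(x, y). f x * g y) has_sum (infsum f A * infsum g B)) (A \<times> B)"
proof -
  have g: "(\<lambda>y. norm (g y)) summable_on B" and f: "(\<lambda>x. norm (f x)) summable_on A"
    using assms by (simp_all add: summable_on_iff_abs_summable_on_complex)
  have "(\<lambda>p. norm (case p of (x, y) \<Rightarrow> f x * g y)) summable_on (A \<times> B)"
    unfolding Infinite_Sum.abs_summable_on_Sigma_iff
    using f g by (auto simp: norm_mult infsum_cmult_right' infsum_nonneg
                       intro!: summable_on_cmult_right summable_on_cmult_left)
  hence "(\<lambda>(x, y). f x * g y) summable_on (A \<times> B)" by (rule abs_summable_summable)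
  moreover from this have "infsum (\<lambda>(x, y). f x * g y) (A \<times> B) = infsum f A * infsum g B"
    by (simp add: infsum_Sigma'_banach[symmetric] infsum_cmult_right' infsum_cmult_left')
  ultimately show ?thesis by (simp add: has_sum_iff)
qed

text \<open>The Gaussian factor \<open>q\<^bsup>n(n+1)/2\<^esup>\<close> makes the ratios of consecutive terms tend to \<open>0\<close> in both
  directions, so the ratio test can be run on each half of \<open>\<int>\<close>.\<close>
lemma summable_on_int_ratio:
  fixes f :: "int \<Rightarrow> complex"
  assumes "\<forall>\<^sub>F k in sequentially. f (int (Suc k)) = \<rho> k * f (int k)" "\<rho> \<longlonglongrightarrow> 0"
    and "\<forall>\<^sub>F k in sequentially. f (- int (Suc k)) = \<sigma> k * f (- int k)" "\<sigma> \<longlonglongrightarrow> 0"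
  shows "f summable_on UNIV"
proof -
  have "f summable_on range int"
    unfolding summable_on_reindex[OF inj_of_nat] o_def
    by (intro norm_summable_imp_summable_on summable_norm_ratio_tendsto[OF assms(1,2)]) simp
  moreover have "summable (\<lambda>k. norm (f (- int (Suc k))))"
    using summable_norm_ratio_tendsto[OF assms(3,4)] unfolding summable_Suc_iff[of "\<lambda>k. norm (f (- int k))"] by simp
  hence "f summable_on range (\<lambda>k. - int (Suc k))"
    by (subst summable_on_reindex) (auto simp: inj_on_def o_def intro: norm_summable_imp_summable_on)
  moreover have "range int \<inter> range (\<lambda>k. - int (Suc k)) = {}" by auto
  moreover have "range int \<union> range (\<lambda>k. - int (Suc k)) = UNIV"
  proof -
    have "n \<in> range int \<union> range (\<lambda>k. - int (Suc k))" for n by (cases n) blast+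
    thus ?thesis by blast
  qed
  ultimately show ?thesis using summable_on_Un_disjoint by metis
qed

lemma has_sum_suminf:
  fixes f :: "nat \<Rightarrow> complex"
  assumes "summable (\<lambda>n. norm (f n))"
  shows "(f has_sum (\<Sum>n. f n)) UNIV"
  by (rule norm_summable_imp_has_sum[OF assms summable_sums[OF summable_norm_cancel[OF assms]]])

lemma has_sum_diff:
  fixes f g :: "'a \<Rightarrow> complex"
  assumes "(f has_sum a) A" "(g has_sum b) A"
  shows "((\<lambda>x. f x - g x) has_sum (a - b)) A"
  using has_sum_add[OF assms(1) has_sum_uminusI[OF assms(2)]] by simp

text \<open>Terms of the theta series in the multiplicative variable \<open>w = e\<^bsup>2\<pi>iv\<^esup>\<close>, stripped of half-integer
  powers so that only integer powers of \<open>q\<close> and \<open>w\<close> occur.\<close>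
definition theta_term :: "complex \<Rightarrow> complex \<Rightarrow> int \<Rightarrow> complex" where
  "theta_term q w n = (-1) powi n * w powi n * q powi (n * (n + 1) div 2)"

lemma theta_term_Suc:
  assumes "q \<noteq> 0" "w \<noteq> 0"
  shows "theta_term q w (n + 1) = - w * q powi (n + 1) * theta_term q w n"
proof -
  have "(n + 1) * (n + 1 + 1) = n * (n + 1) + (n + 1) * 2" by (simp add: algebra_simps)
  hence "(n + 1) * (n + 1 + 1) div 2 = n * (n + 1) div 2 + (n + 1)" by simp
  thus ?thesis using assms by (simp add: theta_term_def power_int_add)
qed

text \<open>Moving the summation index of the theta series by \<open>m\<close> exchanges the coefficients of Euler's
  expansion of \<open>1 / (1/w)\<^sub>\<infinity>\<close> for those of his expansion of \<open>(q\<^bsup>n+1\<^esup>)\<^sub>\<infinity>\<close>. This is the whole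
  algebraic content of the triple product.\<close>
lemma theta_term_add_nat:
  assumes "norm q < 1" "q \<noteq> 0" "w \<noteq> 0"
  shows "theta_term q w (n + int m) * (1 / qpoch q q m * (1 / w) ^ m)
           = theta_term q w n * (euler_coeff q m * (q powi (n + 1)) ^ m)"
proof (induction m)
  case (Suc m)
  have "theta_term q w (n + int (Suc m)) = - w * (q powi (n + 1) * q ^ m) * theta_term q w (n + int m)"
    using theta_term_Suc[OF assms(2,3), of "n + int m"] assms(2)
    by (simp add: add_ac power_int_add)
  hence "theta_term q w (n + int (Suc m)) * (1 / qpoch q q (Suc m) * (1 / w) ^ Suc m)
           = - (q powi (n + 1)) * q ^ m / (1 - q ^ Suc m)
              * (theta_term q w (n + int m) * (1 / qpoch q q m * (1 / w) ^ m))"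
    using assms(3) by (simp add: qpoch_Suc mult_ac)
  also have "\<dots> = theta_term q w n * (euler_coeff q (Suc m) * (q powi (n + 1)) ^ Suc m)"
    unfolding Suc.IH by (simp add: euler_coeff_Suc[OF assms(1)])
  finally show ?case .
qed (simp add: euler_coeff_def)

lemma theta_term_shift:
  assumes "q \<noteq> 0"
  shows "theta_term q (w * q) n = q powi n * theta_term q w n"
  by (simp add: theta_term_def power_int_mult_distrib mult_ac)

lemma backward_ratio_tendsto_0:
  fixes q :: complex
  assumes "norm q < 1" "c \<noteq> 0"
  shows "(\<lambda>k. - (q ^ k / w) * ((q ^ k - z) / (q ^ k - c))) \<longlonglongrightarrow> 0"
proof -
  note q = LIMSEQ_power_zero[OF assms(1)]
  have "(\<lambda>k. q ^ k * (- 1 / w) * ((q ^ k - z) / (q ^ k - c))) \<longlonglongrightarrow> 0 * (- 1 / w) * ((0 - z) / (0 - c))"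
    by (intro tendsto_mult tendsto_const tendsto_diff tendsto_divide q) (use assms(2) in simp)
  thus ?thesis by simp
qed

lemma forward_ratio_tendsto_0:
  fixes q :: complex
  assumes "norm q < 1"
  shows "(\<lambda>k. - w * q ^ Suc k * ((1 - z * q ^ Suc k) / (1 - z' * q ^ Suc k))) \<longlonglongrightarrow> 0"
proof -
  have "(\<lambda>k. - w * q ^ Suc k * ((1 - z * q ^ Suc k) / (1 - z' * q ^ Suc k)))
          \<longlonglongrightarrow> - w * 0 * ((1 - z * 0) / (1 - z' * 0))"
    by (intro tendsto_intros LIMSEQ_Suc[OF LIMSEQ_power_zero[OF assms]]) auto
  thus ?thesis by simp
qed

lemma theta_term_minus_Suc:
  assumes "q \<noteq> 0" "w \<noteq> 0"
  shows "theta_term q w (- int (Suc k)) = - (q ^ k / w) * theta_term q w (- int k)"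
  using theta_term_Suc[OF assms, of "- int (Suc k)"] assms
  by (simp add: power_int_minus field_simps)

lemma theta_term_summable:
  assumes "norm q < 1" "q \<noteq> 0" "w \<noteq> 0"
  shows "theta_term q w summable_on UNIV"
proof (rule summable_on_int_ratio)
  have "theta_term q w (int (Suc k)) = - w * q ^ Suc k * theta_term q w (int k)" for k
    using theta_term_Suc[OF assms(2,3), of "int k"] assms(2) by (simp add: add.commute power_int_add)
  thus "\<forall>\<^sub>F k in sequentially. theta_term q w (int (Suc k)) =
           (- w * q ^ Suc k * ((1 - 0 * q ^ Suc k) / (1 - 0 * q ^ Suc k))) * theta_term q w (int k)"
    by simp
  show "\<forall>\<^sub>F k in sequentially. theta_term q w (- int (Suc k)) = - (q ^ k / w) * theta_term q w (- int k)"
    by (intro always_eventually allI theta_term_minus_Suc assms)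
  show "(\<lambda>k. - (q ^ k / w)) \<longlonglongrightarrow> 0"
    using tendsto_mult_right[OF LIMSEQ_power_zero[OF assms(1)], of "- 1 / w"] by simp
  show "(\<lambda>k. - w * q ^ Suc k * ((1 - 0 * q ^ Suc k) / (1 - 0 * q ^ Suc k))) \<longlonglongrightarrow> 0"
    by (rule forward_ratio_tendsto_0[OF assms(1)])
qed

lemma infsum_int_shift:
  fixes f :: "int \<Rightarrow> complex"
  shows "(\<Sum>\<^sub>\<infinity>n. f (n + 1)) = (\<Sum>\<^sub>\<infinity>n. f n)"
  by (rule infsum_reindex_bij_witness[of _ "\<lambda>n. n - 1" "\<lambda>n. n + 1"]) auto

lemma theta_quasi_periodic:
  assumes "q \<noteq> 0" "w \<noteq> 0"
  shows "(\<Sum>\<^sub>\<infinity>n. theta_term q w n) = - w * q * (\<Sum>\<^sub>\<infinity>n. theta_term q (w * q) n)"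
proof -
  have "theta_term q w (n + 1) = - w * q * theta_term q (w * q) n" for n
    unfolding theta_term_Suc[OF assms] theta_term_shift[OF assms(1)]
    using assms by (simp add: power_int_add)
  hence "(\<Sum>\<^sub>\<infinity>n. theta_term q w n) = (\<Sum>\<^sub>\<infinity>n. - w * q * theta_term q (w * q) n)"
    by (subst infsum_int_shift[symmetric]) simp
  thus ?thesis by (simp only: infsum_cmult_right')
qed

lemma norm_reciprocal_less_1:
  fixes y :: complex
  assumes "norm y > 1"
  shows "norm (1 / y) < 1"
  using assms by (simp add: norm_divide divide_less_eq_1)

text \<open>Andrews' argument. For \<open>\<bar>w\<bar> > 1\<close> the product of the theta series with the expansion of
  \<open>1 / (1/w)\<^sub>\<infinity>\<close> converges absolutely; reindexing the double sum turns it into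
  \<open>\<Sum>\<^sub>n (-1)\<^sup>n w\<^sup>n q\<^bsup>n(n+1)/2\<^esup> (q\<^bsup>n+1\<^esup>)\<^sub>\<infinity>\<close>. There the terms with \<open>n < 0\<close> vanish, and the others are Euler's
  expansion of \<open>(q)\<^sub>\<infinity> (wq)\<^sub>\<infinity>\<close>.\<close>
lemma jacobi_triple_product:
  assumes "norm q < 1" "q \<noteq> 0" "norm w > 1"
  shows "(\<Sum>\<^sub>\<infinity>n. theta_term q w n) = qpoch_inf q q * qpoch_inf q (w * q) * qpoch_inf q (1 / w)"
proof -
  have w: "w \<noteq> 0" "norm (1 / w) < 1" using assms(3) norm_reciprocal_less_1 by auto
  define T where "T = (\<Sum>\<^sub>\<infinity>n. theta_term q w n)"
  have e: "((\<lambda>m. 1 / qpoch q q m * (1 / w) ^ m) has_sum (1 / qpoch_inf q (1 / w))) UNIV"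
    using has_sum_suminf[OF euler_inverse_summable[OF assms(1) w(2)]] unfolding euler_inverse[OF assms(1) w(2)] .
  have E: "((\<lambda>m. euler_coeff q m * x ^ m) has_sum qpoch_inf q x) UNIV" for x
    using has_sum_suminf[OF euler_product_summable[OF assms(1)]] unfolding euler_product[OF assms(1)] .
  have "((\<lambda>(N, m). theta_term q w N * (1 / qpoch q q m * (1 / w) ^ m)) has_sum (T * (1 / qpoch_inf q (1 / w))))
          (UNIV \<times> UNIV)"
    using has_sum_times_product[OF theta_term_summable[OF assms(1,2) w(1)] has_sum_imp_summable[OF e]]
    unfolding infsumI[OF e] T_def .
  also have "?this \<longleftrightarrow> ((\<lambda>(n, m). theta_term q w n * (euler_coeff q m * (q powi (n + 1)) ^ m))
                        has_sum (T * (1 / qpoch_inf q (1 / w)))) (UNIV \<times> UNIV)"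
    by (rule has_sum_reindex_bij_witness[of _ "\<lambda>(n, m). (n + int m, m)" "\<lambda>(N, m). (N - int m, m)"])
      (auto simp: theta_term_add_nat[OF assms(1,2) w(1), symmetric])
  finally have 1: "((\<lambda>n. theta_term q w n * qpoch_inf q (q powi (n + 1)))
                 has_sum (T * (1 / qpoch_inf q (1 / w)))) UNIV"
    by (rule has_sum_SigmaD) (auto intro!: has_sum_cmult_right E)
  have zero: "qpoch_inf q (q powi (n + 1)) = 0" if "n < 0" for n
  proof -
    define j where "j = nat (- (n + 1))"
    have "n + 1 = - int j" using that by (simp add: j_def)
    hence "q powi (n + 1) * q ^ j = 1" using assms(2) by (simp add: power_int_minus)
    thus ?thesis by (rule qpoch_inf_eq_0[OF assms(1)])
  qed
  have pos: "theta_term q w (int k) * qpoch_inf q (q powi (int k + 1))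
              = qpoch_inf q q * (euler_coeff q k * (w * q) ^ k)" for k
  proof -
    have "theta_term q w (int k) / qpoch q q k = euler_coeff q k * (w * q) ^ k"
    proof -
      have "theta_term q w 0 = 1" by (simp add: theta_term_def)
      hence "theta_term q w (int k) * (1 / qpoch q q k * (1 / w) ^ k) = euler_coeff q k * q ^ k"
        using theta_term_add_nat[OF assms(1,2) w(1), of 0 k] by simp
      thus ?thesis using w(1) qpoch_nonzero[OF assms(1), of k] by (simp add: power_mult_distrib power_one_over field_simps)
    qed
    moreover have "qpoch_inf q q = qpoch q q k * qpoch_inf q (q powi (int k + 1))"
      using qpoch_inf_split[OF assms(1), of q k] assms(2) by (simp add: power_int_add)
    ultimately show ?thesis using qpoch_nonzero[OF assms(1), of k] by (simp add: field_simps)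
  qed
  have "((\<lambda>n. theta_term q w n * qpoch_inf q (q powi (n + 1))) has_sum (qpoch_inf q q * qpoch_inf q (w * q))) (range int)"
    unfolding has_sum_reindex[OF inj_of_nat] o_def pos by (intro has_sum_cmult_right E)
  also have "?this \<longleftrightarrow> ((\<lambda>n. theta_term q w n * qpoch_inf q (q powi (n + 1)))
                        has_sum (qpoch_inf q q * qpoch_inf q (w * q))) UNIV"
  proof (rule has_sum_cong_neutral)
    fix n :: int assume "n \<in> UNIV - range int"
    hence "n < 0" by (cases n) auto
    thus "theta_term q w n * qpoch_inf q (q powi (n + 1)) = 0" by (simp add: zero)
  qed auto
  finally have "T * (1 / qpoch_inf q (1 / w)) = qpoch_inf q q * qpoch_inf q (w * q)"
    using has_sum_unique[OF 1] by simp
  thus ?thesis using qpoch_inf_nonzero_disc[OF assms(1) w(2)] by (simp add: T_def field_simps)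
qed

text \<open>Quasi-periodicity moves \<open>w\<close> into the region \<open>\<bar>w\<bar> > 1\<close>, where the product shows the zeros.\<close>
lemma theta_nonzero:
  assumes "norm q < 1" "q \<noteq> 0" "w \<noteq> 0" "\<And>n::int. w \<noteq> q powi n"
  shows "(\<Sum>\<^sub>\<infinity>n. theta_term q w n) \<noteq> 0"
proof -
  have descend: "(\<Sum>\<^sub>\<infinity>n. theta_term q (w / q ^ k) n) = 0 \<longleftrightarrow> (\<Sum>\<^sub>\<infinity>n. theta_term q w n) = 0" for k
  proof (induction k)
    case (Suc k)
    have "w / q ^ Suc k * q = w / q ^ k" using assms(2) by simp
    thus ?case using theta_quasi_periodic[of q "w / q ^ Suc k"] assms Suc.IH by simp
  qed simp
  obtain k where k: "norm q ^ k < norm w"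
    using real_arch_pow_inv[of "norm w" "norm q"] assms(1,3) by auto
  have big: "norm (w / q ^ k) > 1" using k assms(2) by (simp add: norm_divide norm_power)
  have "w / q ^ k * q * q ^ j \<noteq> 1" for j
  proof
    assume "w / q ^ k * q * q ^ j = 1"
    hence "w = q powi (int k - 1 - int j)" using assms(2) by (simp add: power_int_diff power_int_add field_simps)
    thus False using assms(4) by blast
  qed
  hence "qpoch_inf q (w / q ^ k * q) \<noteq> 0" by (rule qpoch_inf_nonzero[OF assms(1)])
  moreover have "qpoch_inf q (1 / (w / q ^ k)) \<noteq> 0"
    by (rule qpoch_inf_nonzero_disc[OF assms(1) norm_reciprocal_less_1[OF big]])
  moreover have "qpoch_inf q q \<noteq> 0"
    by (rule qpoch_inf_nonzero_disc[OF assms(1,1)])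
  ultimately have "(\<Sum>\<^sub>\<infinity>n. theta_term q (w / q ^ k) n) \<noteq> 0"
    unfolding jacobi_triple_product[OF assms(1,2) big] by (simp only: mult_eq_0_iff simp_thms)
  thus ?thesis by (simp add: descend)
qed

section \<open>Contiguous relation for the bilateral series\<close>

text \<open>Terms of the series in the generalized \<open>\<mu>\<close>-function, with \<open>z = e\<^bsup>2\<pi>iu\<^esup>\<close>. The parameter \<open>\<alpha>\<close> enters only
  through \<open>\<beta> = q\<^bsup>-\<alpha>\<^esup>\<close>, so that lowering \<open>\<alpha>\<close> by one multiplies \<open>\<beta>\<close> by \<open>q\<close>.\<close>
definition bilateral_term :: "complex \<Rightarrow> complex \<Rightarrow> complex \<Rightarrow> complex \<Rightarrow> int \<Rightarrow> complex" where
  "bilateral_term q w z \<beta> n =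
     theta_term q w n * (qpoch_inf q (z * q powi (n + 1)) / qpoch_inf q (z * \<beta> * q powi (n + 1)))"

definition bilateral_sum :: "complex \<Rightarrow> complex \<Rightarrow> complex \<Rightarrow> complex \<Rightarrow> complex" where
  "bilateral_sum q w z \<beta> = (\<Sum>\<^sub>\<infinity>n. bilateral_term q w z \<beta> n)"

context
  fixes q w z :: complex
  assumes q: "norm q < 1" "q \<noteq> 0" and w: "w \<noteq> 0" and z: "z \<noteq> 0"
begin

lemma bilateral_term_mult_q:
  assumes "\<And>n::int. z * \<beta> * q powi n \<noteq> 1"
  shows "bilateral_term q w z (\<beta> * q) n = (1 - z * \<beta> * q powi (n + 1)) * bilateral_term q w z \<beta> n"
proof -
  have "qpoch_inf q (z * \<beta> * q powi (n + 1))
          = (1 - z * \<beta> * q powi (n + 1)) * qpoch_inf q (z * (\<beta> * q) * q powi (n + 1))"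
    using qpoch_inf_step[OF q(1), of "z * \<beta> * q powi (n + 1)"] by (simp add: mult_ac)
  thus ?thesis using assms[of "n + 1"] by (simp add: bilateral_term_def)
qed

lemma bilateral_term_Suc:
  "q powi (n + 1) * bilateral_term q w z (\<beta> * q) n
     = - (1 / w) * (1 - z * q powi (n + 1)) * bilateral_term q w z \<beta> (n + 1)"
proof -
  have "q powi (n + 1 + 1) = q powi (n + 1) * q" using q(2) by (simp add: power_int_add power2_eq_square)
  thus ?thesis
    using qpoch_inf_step[OF q(1), of "z * q powi (n + 1)"] w
    by (simp add: bilateral_term_def theta_term_Suc[OF q(2) w] mult_ac)
qed

text \<open>For \<open>Q = q\<^sup>k\<close>, \<open>R = q\<^bsup>-k\<^esup>\<close>: removes the growing powers of \<open>q\<close> from the ratio of consecutive terms at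
  index \<open>-k\<close>, so that its limit can be read off.\<close>
lemma clear_inverse:
  fixes Q R a b c :: complex
  assumes "Q * R = 1" "- w * R * ((1 - c * R) * a) = (1 - z * R) * b"
  shows "- w * ((Q - c) * a) = Q * (Q - z) * b"
proof -
  have "- w * ((Q - c) * a) = Q * Q * (- w * R * ((1 - c * R) * a))"
    using assms(1) by algebra
  also have "\<dots> = Q * (Q - z) * b"
    unfolding assms(2) using assms(1) by algebra
  finally show ?thesis .
qed

lemma bilateral_summable:
  assumes \<beta>: "\<beta> \<noteq> 0" "\<And>n::int. z * \<beta> * q powi n \<noteq> 1"
  shows "bilateral_term q w z \<beta> summable_on UNIV"
proof (rule summable_on_int_ratio)
  have ratio: "- w * q powi (n + 1) * ((1 - z * \<beta> * q powi (n + 1)) * bilateral_term q w z \<beta> n)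
      = (1 - z * q powi (n + 1)) * bilateral_term q w z \<beta> (n + 1)" for n
    using bilateral_term_Suc[of n \<beta>] w unfolding bilateral_term_mult_q[OF \<beta>(2)]
    by (simp add: field_simps)
  have "\<forall>\<^sub>F k in sequentially. z * q ^ Suc k \<noteq> 1"
    using tendsto_imp_eventually_ne[OF LIMSEQ_Suc[OF power_tendsto_0[OF q(1), of z]], of 1] by simp
  thus "\<forall>\<^sub>F k in sequentially. bilateral_term q w z \<beta> (int (Suc k)) =
      (- w * q ^ Suc k * ((1 - z * \<beta> * q ^ Suc k) / (1 - z * q ^ Suc k))) * bilateral_term q w z \<beta> (int k)"
  proof eventually_elim
    case (elim k)
    have "q powi (int k + 1) = q ^ Suc k" using q(2) by (simp add: power_int_add)
    thus ?case using ratio[of "int k"] elim by (simp add: field_simps)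
  qed
  show "\<forall>\<^sub>F k in sequentially. bilateral_term q w z \<beta> (- int (Suc k)) =
      (- (q ^ k / w) * ((q ^ k - z) / (q ^ k - z * \<beta>))) * bilateral_term q w z \<beta> (- int k)"
  proof (intro always_eventually allI)
    fix k
    have "q ^ k \<noteq> z * \<beta>" using \<beta>(2)[of "- int k"] q(2) by (auto simp: power_int_minus field_simps)
    moreover have "- w * ((q ^ k - z * \<beta>) * bilateral_term q w z \<beta> (- int (Suc k)))
                     = q ^ k * (q ^ k - z) * bilateral_term q w z \<beta> (- int k)"
    proof -
      have "q ^ k * q powi (- int k) = 1" using q(2) by (simp add: power_int_minus)
      moreover have "- int (Suc k) + 1 = - int k" by simp
      ultimately show ?thesis using ratio[of "- int (Suc k)"] by (metis clear_inverse)
    qed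
    ultimately show "bilateral_term q w z \<beta> (- int (Suc k)) =
      (- (q ^ k / w) * ((q ^ k - z) / (q ^ k - z * \<beta>))) * bilateral_term q w z \<beta> (- int k)"
      using w by (simp add: field_simps)
  qed
qed (use \<beta> z in \<open>simp_all only: backward_ratio_tendsto_0[OF q(1)] forward_ratio_tendsto_0[OF q(1)] mult_eq_0_iff not_False_eq_True simp_thms\<close>)

text \<open>There are two ways to pass from \<open>\<beta>\<close> to \<open>\<beta> q\<close> in a term: with the index fixed, and with the index
  raised by one. Summed over \<open>n\<close>, each is a linear relation between the series \<open>A\<close> and its
  companion \<open>B\<close> weighted by \<open>q\<^sup>n\<close>; eliminating \<open>B\<close> leaves three values of \<open>A\<close>.\<close>
lemma bilateral_sum_recurrence:
  assumes \<beta>: "\<beta> \<noteq> 0" "\<And>n::int. z * \<beta> * q powi n \<noteq> 1"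
  shows "z * (\<beta> * q - 1) * bilateral_sum q w z \<beta>
           = w * bilateral_sum q w z (\<beta> * q\<^sup>2) - (w + z) * bilateral_sum q w z (\<beta> * q)"
proof -
  define A where "A = bilateral_sum q w z"
  define B where "B \<gamma> = (\<Sum>\<^sub>\<infinity>n. q powi n * bilateral_term q w z \<gamma> n)" for \<gamma>
  have \<beta>q: "\<beta> * q \<noteq> 0" "z * (\<beta> * q) * q powi n \<noteq> 1" for n
    using \<beta>(1) q(2) \<beta>(2)[of "n + 1"] by (auto simp: power_int_add mult_ac)
  have 1: "(\<lambda>n. q powi n * bilateral_term q w z \<gamma> n) summable_on UNIV
           \<and> A \<gamma> - z * \<gamma> * q * B \<gamma> = A (\<gamma> * q)"
    if \<gamma>: "\<gamma> \<noteq> 0" "\<And>n::int. z * \<gamma> * q powi n \<noteq> 1" for \<gamma>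
  proof -
    have \<gamma>q: "\<gamma> * q \<noteq> 0" "z * (\<gamma> * q) * q powi n \<noteq> 1" for n
      using \<gamma>(1) q(2) \<gamma>(2)[of "n + 1"] by (auto simp: power_int_add mult_ac)
    have "((\<lambda>n. bilateral_term q w z \<gamma> n - bilateral_term q w z (\<gamma> * q) n) has_sum (A \<gamma> - A (\<gamma> * q))) UNIV"
      unfolding A_def bilateral_sum_def
      by (intro has_sum_diff has_sum_infsum bilateral_summable \<gamma> \<gamma>q)
    also have "(\<lambda>n. bilateral_term q w z \<gamma> n - bilateral_term q w z (\<gamma> * q) n)
                 = (\<lambda>n. (z * \<gamma> * q) * (q powi n * bilateral_term q w z \<gamma> n))"
      using q(2) by (simp add: bilateral_term_mult_q[OF \<gamma>(2)] power_int_add algebra_simps)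
    finally have "((\<lambda>n. (z * \<gamma> * q) * (q powi n * bilateral_term q w z \<gamma> n)) has_sum (A \<gamma> - A (\<gamma> * q))) UNIV" .
    moreover have "z * \<gamma> * q \<noteq> 0" using z \<gamma> q by simp
    ultimately have s: "(\<lambda>n. q powi n * bilateral_term q w z \<gamma> n) summable_on UNIV"
      and "z * \<gamma> * q * B \<gamma> = A \<gamma> - A (\<gamma> * q)"
      unfolding B_def by (auto simp: has_sum_iff infsum_cmult_right' summable_on_cmult_right')
    thus ?thesis by (simp add: algebra_simps)
  qed
  have "q * B (\<beta> * q) = (\<Sum>\<^sub>\<infinity>n. q powi (n + 1) * bilateral_term q w z (\<beta> * q) n)"
    unfolding B_def infsum_cmult_right'[symmetric] using q(2) by (simp add: power_int_add mult_ac)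
  also have "\<dots> = (\<Sum>\<^sub>\<infinity>n. - (1 / w) * (1 - z * q powi (n + 1)) * bilateral_term q w z \<beta> (n + 1))"
    by (simp only: bilateral_term_Suc)
  also have "\<dots> = (\<Sum>\<^sub>\<infinity>n. - (1 / w) * (1 - z * q powi n) * bilateral_term q w z \<beta> n)"
    by (rule infsum_int_shift)
  also have "\<dots> = (\<Sum>\<^sub>\<infinity>n. - (1 / w) * (bilateral_term q w z \<beta> n - z * (q powi n * bilateral_term q w z \<beta> n)))"
    by (simp add: algebra_simps)
  also have "\<dots> = - (1 / w) * (A \<beta> - z * B \<beta>)"
    unfolding A_def B_def bilateral_sum_def
    by (intro infsumI has_sum_cmult_right has_sum_diff has_sum_infsum bilateral_summable[OF \<beta>] 1[OF \<beta>, THEN conjunct1])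
  finally have wB: "w * (q * B (\<beta> * q)) = z * B \<beta> - A \<beta>" using w by (simp add: field_simps)
  have A1: "z * \<beta> * q * B \<beta> = A \<beta> - A (\<beta> * q)"
    using 1[OF \<beta>] by (simp add: algebra_simps)
  have "A (\<beta> * q\<^sup>2) = A (\<beta> * q) - z * \<beta> * q * (q * B (\<beta> * q))"
    using 1[OF \<beta>q] by (simp add: power2_eq_square mult_ac)
  hence "w * A (\<beta> * q\<^sup>2) = w * A (\<beta> * q) - z * \<beta> * q * (w * (q * B (\<beta> * q)))"
    by (simp only: right_diff_distrib mult_ac)
  also have "\<dots> = w * A (\<beta> * q) - z * (z * \<beta> * q * B \<beta>) + z * \<beta> * q * A \<beta>"
    unfolding wB by (simp add: algebra_simps)
  finally have "z * (\<beta> * q - 1) * A \<beta> = w * A (\<beta> * q\<^sup>2) - (w + z) * A (\<beta> * q)"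
    unfolding A1 by (simp add: algebra_simps)
  thus ?thesis by (simp add: A_def)
qed

end

section \<open>Rogers-Szego polynomials and the q-Appell function\<close>

lemma has_sum_antidiagonal:
  fixes f :: "nat \<times> nat \<Rightarrow> complex"
  assumes "(f has_sum s) (UNIV \<times> UNIV)"
  shows "(\<lambda>N. \<Sum>a\<le>N. f (a, N - a)) sums s"
proof -
  have "((\<lambda>(N, a). f (a, N - a)) has_sum s) (SIGMA N:UNIV. {..N})"
    using assms by (subst has_sum_reindex_bij_witness[of _ "\<lambda>(a, b). (a + b, a)" "\<lambda>(N, a). (a, N - a)"]) auto
  hence "((\<lambda>N. \<Sum>a\<le>N. f (a, N - a)) has_sum s) UNIV"
    by (rule has_sum_SigmaD) auto
  thus ?thesis by (rule has_sum_imp_sums)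
qed

text \<open>The homogeneous Rogers-Szego polynomial \<open>\<Sum>\<^sub>a [N choose a]\<^sub>q X\<^sup>a Y\<^bsup>N-a\<^esup>\<close> divided by \<open>(q)\<^sub>N\<close>.\<close>
definition rs_coeff :: "complex \<Rightarrow> complex \<Rightarrow> complex \<Rightarrow> nat \<Rightarrow> complex" where
  "rs_coeff q X Y N = (\<Sum>a\<le>N. X ^ a / qpoch q q a * (Y ^ (N - a) / qpoch q q (N - a)))"

lemma rs_coeff_0 [simp]: "rs_coeff q X Y 0 = 1"
  by (simp add: rs_coeff_def)

lemma euler_inverse_coeff_Suc:
  assumes "norm q < 1"
  shows "(1 - q ^ Suc a) * (X ^ Suc a / qpoch q q (Suc a)) = X * (X ^ a / qpoch q q a)"
  using one_minus_power_nonzero[OF assms, of a] by (simp add: qpoch_Suc)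

lemma convolution_left:
  fixes g :: "nat \<Rightarrow> complex"
  assumes "norm q < 1"
  shows "(\<Sum>a\<le>Suc N. (1 - q ^ a) * (X ^ a / qpoch q q a) * g (Suc N - a))
           = X * (\<Sum>a\<le>N. X ^ a / qpoch q q a * g (N - a))"
  unfolding sum.atMost_Suc_shift euler_inverse_coeff_Suc[OF assms] sum_distrib_left
  by (simp add: mult_ac)

lemma convolution_right:
  fixes f :: "nat \<Rightarrow> complex"
  assumes "norm q < 1"
  shows "(\<Sum>a\<le>Suc N. f a * ((1 - q ^ (Suc N - a)) * (Y ^ (Suc N - a) / qpoch q q (Suc N - a))))
           = Y * (\<Sum>a\<le>N. f a * (Y ^ (N - a) / qpoch q q (N - a)))"
proof -
  have "(\<Sum>a\<le>N. f a * ((1 - q ^ (Suc N - a)) * (Y ^ (Suc N - a) / qpoch q q (Suc N - a))))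
         = (\<Sum>a\<le>N. f a * (Y * (Y ^ (N - a) / qpoch q q (N - a))))"
  proof (intro sum.cong refl)
    fix a assume "a \<in> {..N}"
    thus "f a * ((1 - q ^ (Suc N - a)) * (Y ^ (Suc N - a) / qpoch q q (Suc N - a)))
            = f a * (Y * (Y ^ (N - a) / qpoch q q (N - a)))"
      using euler_inverse_coeff_Suc[OF assms, of "N - a" Y] by (simp only: Suc_diff_le atMost_iff)
  qed
  thus ?thesis by (simp add: sum_distrib_left mult_ac)
qed

text \<open>From \<open>1 - q\<^bsup>a+b\<^esup> = (1 - q\<^sup>a) + q\<^sup>a (1 - q\<^sup>b)\<close>: either summand cancels the last factor of one of
  the two denominators \<open>(q)\<^sub>a\<close>, \<open>(q)\<^sub>b\<close>.\<close>
lemma rs_coeff_split: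
  assumes "norm q < 1"
  shows "(1 - q ^ Suc N) * rs_coeff q X Y (Suc N) = X * rs_coeff q X Y N
    + Y * (\<Sum>a\<le>N. q ^ a * (X ^ a / qpoch q q a) * (Y ^ (N - a) / qpoch q q (N - a)))"
proof -
  define g where "g b = Y ^ b / qpoch q q b" for b
  have "(1 - q ^ Suc N) * (X ^ a / qpoch q q a * g (Suc N - a))
          = (1 - q ^ a) * (X ^ a / qpoch q q a) * g (Suc N - a)
            + q ^ a * (X ^ a / qpoch q q a) * ((1 - q ^ (Suc N - a)) * g (Suc N - a))"
    if "a \<le> Suc N" for a
  proof -
    have "q ^ Suc N = q ^ a * q ^ (Suc N - a)" using that by (simp flip: power_add)
    moreover have "(1 - b * c) * (d * e) = (1 - b) * d * e + b * d * ((1 - c) * e)" for b c d e :: complex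
      by (simp add: algebra_simps)
    ultimately show ?thesis by (simp only:)
  qed
  hence "(1 - q ^ Suc N) * rs_coeff q X Y (Suc N)
      = (\<Sum>a\<le>Suc N. (1 - q ^ a) * (X ^ a / qpoch q q a) * g (Suc N - a))
        + (\<Sum>a\<le>Suc N. q ^ a * (X ^ a / qpoch q q a) * ((1 - q ^ (Suc N - a)) * g (Suc N - a)))"
    unfolding rs_coeff_def sum_distrib_left sum.distrib[symmetric] g_def
    by (intro sum.cong) auto
  thus ?thesis
    unfolding convolution_left[OF assms] unfolding g_def convolution_right[OF assms] rs_coeff_def .
qed

lemma rs_coeff_1:
  assumes "norm q < 1"
  shows "(1 - q) * rs_coeff q X Y (Suc 0) = X + Y"
  using rs_coeff_split[OF assms, of 0 X Y] by simp

text \<open>Apply the splitting once more, writing the weight \<open>q\<^sup>a\<close> that it leaves as \<open>1 - (1 - q\<^sup>a)\<close>.\<close>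
lemma rs_coeff_recurrence:
  assumes "norm q < 1"
  shows "(1 - q ^ Suc (Suc N)) * rs_coeff q X Y (Suc (Suc N))
           = (X + Y) * rs_coeff q X Y (Suc N) - X * Y * rs_coeff q X Y N"
proof -
  define g where "g b = Y ^ b / qpoch q q b" for b
  have "(\<Sum>a\<le>Suc N. q ^ a * (X ^ a / qpoch q q a) * g (Suc N - a))
      = (\<Sum>a\<le>Suc N. X ^ a / qpoch q q a * g (Suc N - a))
        - (\<Sum>a\<le>Suc N. (1 - q ^ a) * (X ^ a / qpoch q q a) * g (Suc N - a))"
    unfolding sum_subtractf[symmetric] by (intro sum.cong refl) (simp only: left_diff_distrib mult_1_left, simp)
  also have "\<dots> = rs_coeff q X Y (Suc N) - X * rs_coeff q X Y N"
    unfolding convolution_left[OF assms] by (simp only: rs_coeff_def g_def)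
  finally show ?thesis
    unfolding rs_coeff_split[OF assms, of "Suc N"] g_def by (simp only:) (simp add: algebra_simps)
qed

lemma has_sum_euler_inverse_product:
  assumes "norm q < 1" "norm (x * X) < 1" "norm (x * Y) < 1"
  shows "((\<lambda>(a, b). (1 / qpoch q q a * (x * X) ^ a) * (1 / qpoch q q b * (x * Y) ^ b))
           has_sum (1 / (qpoch_inf q (x * X) * qpoch_inf q (x * Y)))) (UNIV \<times> UNIV)"
proof -
  have *: "((\<lambda>a. 1 / qpoch q q a * y ^ a) has_sum (1 / qpoch_inf q y)) UNIV" if "norm y < 1" for y
    using has_sum_suminf[OF euler_inverse_summable[OF assms(1) that]] unfolding euler_inverse[OF assms(1) that] .
  show ?thesis
    using has_sum_times_product[OF has_sum_imp_summable[OF *[OF assms(2)]] has_sum_imp_summable[OF *[OF assms(3)]]]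
    unfolding infsumI[OF *[OF assms(2)]] infsumI[OF *[OF assms(3)]] by simp
qed

lemma rs_coeff_power:
  "(\<Sum>a\<le>N. (1 / qpoch q q a * (x * X) ^ a) * (1 / qpoch q q (N - a) * (x * Y) ^ (N - a)))
     = rs_coeff q X Y N * x ^ N"
  unfolding rs_coeff_def sum_distrib_right
proof (intro sum.cong refl)
  fix a assume "a \<in> {..N}"
  hence "x ^ N = x ^ a * x ^ (N - a)" by (simp flip: power_add)
  thus "(1 / qpoch q q a * (x * X) ^ a) * (1 / qpoch q q (N - a) * (x * Y) ^ (N - a))
          = X ^ a / qpoch q q a * (Y ^ (N - a) / qpoch q q (N - a)) * x ^ N"
    by (simp add: power_mult_distrib)
qed

lemma rs_generating_function:
  assumes "norm q < 1" "norm (x * X) < 1" "norm (x * Y) < 1"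
  shows "(\<lambda>N. rs_coeff q X Y N * x ^ N) sums (1 / (qpoch_inf q (x * X) * qpoch_inf q (x * Y)))"
  using has_sum_antidiagonal[OF has_sum_euler_inverse_product[OF assms]]
  unfolding prod.case rs_coeff_power .

lemma qpoch_q2:
  "(1 - q) * qpoch q (q\<^sup>2) n = qpoch q q (Suc n)"
  by (induction n) (simp_all add: qpoch_Suc power2_eq_square mult_ac)

text \<open>For these parameters the quotient \<open>(q)\<^bsub>m+n\<^esub> / (q\<^sup>2)\<^bsub>m+n\<^esub>\<close> equals \<open>(1 - q) / (1 - q\<^bsup>m+n+1\<^esup>)\<close>, a bounded
  function of \<open>m + n\<close>. So the double series converges absolutely, and along antidiagonals it only
  reweights the generating function of the Rogers-Szego polynomials.\<close>
lemma q_appell1_sums: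
  assumes "norm q < 1" "norm (x * X) < 1" "norm (x * Y) < 1"
  shows "(\<lambda>N. (1 - q) / (1 - q ^ Suc N) * (rs_coeff q X Y N * x ^ N)) sums
           q_appell1 q 0 0 (q\<^sup>2) q (x * X) (x * Y)"
proof -
  define f where "f = (\<lambda>(a, b). (1 / qpoch q q a * (x * X) ^ a) * (1 / qpoch q q b * (x * Y) ^ b))"
  define g where "g = (\<lambda>(a, b). (1 - q) / (1 - q ^ Suc (a + b)) * f (a, b))"
  have quot: "qpoch q q n / qpoch q (q\<^sup>2) n = (1 - q) / (1 - q ^ Suc n)" for n
  proof -
    have "1 - q \<noteq> 0" using one_minus_power_nonzero[OF assms(1), of 0] by simp
    hence "qpoch q (q\<^sup>2) n = qpoch q q n * (1 - q ^ Suc n) / (1 - q)"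
      using qpoch_q2[of q n] by (simp add: qpoch_Suc nonzero_eq_divide_eq mult.commute)
    thus ?thesis using qpoch_nonzero[OF assms(1), of n] by simp
  qed
  have g: "g (m, n) = qpoch q q (m + n) * qpoch q 0 m * qpoch q 0 n
      / (qpoch q (q\<^sup>2) (m + n) * qpoch q q m * qpoch q q n) * (x * X) ^ m * (x * Y) ^ n" for m n
    unfolding g_def f_def prod.case quot[symmetric] by (simp add: mult.assoc)
  have bound: "norm (g p) \<le> norm (1 - q) / (1 - norm q) * norm (f p)" for p
  proof (cases p)
    case (Pair a b)
    have "norm (q ^ Suc (a + b)) \<le> norm q"
      using assms(1) power_le_one[of "norm q" "a + b"] by (simp add: norm_mult norm_power mult_left_le)
    hence "1 - norm q \<le> norm (1 - q ^ Suc (a + b))"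
      using norm_triangle_ineq2[of 1 "q ^ Suc (a + b)"] by simp
    hence "norm ((1 - q) / (1 - q ^ Suc (a + b))) \<le> norm (1 - q) / (1 - norm q)"
      unfolding norm_divide using assms(1) by (intro divide_left_mono mult_pos_pos) auto
    thus ?thesis unfolding Pair g_def prod.case norm_mult by (rule mult_right_mono) simp
  qed
  have "f summable_on UNIV \<times> UNIV"
    using has_sum_euler_inverse_product[OF assms] unfolding f_def by (rule has_sum_imp_summable)
  hence "(\<lambda>p. norm (1 - q) / (1 - norm q) * norm (f p)) summable_on UNIV \<times> UNIV"
    by (intro summable_on_cmult_right) (simp add: summable_on_iff_abs_summable_on_complex)
  hence "(\<lambda>p. norm (g p)) summable_on UNIV \<times> UNIV"
    by (rule summable_on_comparison_test) (use bound in auto)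
  hence "g summable_on UNIV \<times> UNIV" by (rule abs_summable_summable)
  from has_sum_antidiagonal[OF has_sum_infsum[OF this]]
  have "(\<lambda>N. \<Sum>a\<le>N. g (a, N - a)) sums infsum g UNIV" by simp
  also have "infsum g UNIV = q_appell1 q 0 0 (q\<^sup>2) q (x * X) (x * Y)"
    unfolding q_appell1_def by (intro infsum_cong) (auto simp: g)
  also have "(\<lambda>N. \<Sum>a\<le>N. g (a, N - a)) = (\<lambda>N. (1 - q) / (1 - q ^ Suc N) * (rs_coeff q X Y N * x ^ N))"
  proof
    fix N
    show "(\<Sum>a\<le>N. g (a, N - a)) = (1 - q) / (1 - q ^ Suc N) * (rs_coeff q X Y N * x ^ N)"
      unfolding rs_coeff_power[symmetric] sum_distrib_left by (intro sum.cong) (auto simp: g_def f_def)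
  qed
  finally show ?thesis .
qed

lemma qpoch_inf_tendsto_1:
  assumes "norm q < 1"
  shows "(\<lambda>n. qpoch_inf q (x * q ^ n)) \<longlonglongrightarrow> 1"
  using powser_mult_q_tendsto[OF assms summable_norm_cancel[OF euler_product_summable[OF assms, of x]]]
  unfolding euler_product[OF assms] by (simp add: euler_coeff_def)

section \<open>Power series with three-term recurrent coefficients\<close>

text \<open>The value \<open>p\<close> stands for the coefficient \<open>s\<^bsub>-1\<^esub>\<close>, and \<open>case_nat p s k\<close> is thus \<open>s\<^bsub>k-1\<^esub>\<close>.\<close>
context
  fixes q X Y p :: complex and s :: "nat \<Rightarrow> complex"
  assumes q: "norm q < 1"
    and XY: "X * Y = 1"
    and rec: "\<And>k. (1 - q ^ Suc k) * s (Suc k) = q ^ Suc k * (case_nat p s k - (X + Y) * s k)"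
begin

lemma three_term_series_q_difference:
  assumes "summable (\<lambda>k. s k * r ^ k)"
  shows "(\<Sum>k. s k * r ^ k)
    = (1 - r * X * q) * (1 - r * Y * q) * (\<Sum>k. s k * (r * q) ^ k) + p * q * r"
proof -
  define S where "S x = (\<Sum>k. s k * x ^ k)" for x
  have s1: "summable (\<lambda>k. s k * (r * q) ^ k)" by (rule powser_summable_mult_q[OF q assms])
  have "summable (\<lambda>k. r * q * (s k * (r * q) ^ k))" by (rule summable_mult[OF s1])
  hence s2: "summable (\<lambda>k. case_nat p s k * (r * q) ^ k)"
    by (subst summable_Suc_iff[symmetric]) (simp add: mult_ac)
  have "(\<Sum>k. case_nat p s k * (r * q) ^ k) = (\<Sum>k. r * q * (s k * (r * q) ^ k)) + p"
    using suminf_split_head[OF s2] by (simp add: mult_ac algebra_simps)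
  also have "\<dots> = p + r * q * S (r * q)"
    using suminf_mult[OF s1, of "r * q"] by (simp add: S_def)
  finally have head: "(\<Sum>k. case_nat p s k * (r * q) ^ k) = p + r * q * S (r * q)" .
  have "S r - S (r * q) = r * (\<Sum>k. s (Suc k) * (1 - q ^ Suc k) * r ^ k)"
    unfolding S_def by (rule powser_q_difference[OF q assms])
  also have "(\<lambda>k. s (Suc k) * (1 - q ^ Suc k) * r ^ k)
      = (\<lambda>k. q * (case_nat p s k * (r * q) ^ k - (X + Y) * (s k * (r * q) ^ k)))"
  proof
    fix k
    have "s (Suc k) * (1 - q ^ Suc k) * r ^ k = q ^ Suc k * (case_nat p s k - (X + Y) * s k) * r ^ k"
      using rec[of k] by (simp only: mult.commute)
    thus "s (Suc k) * (1 - q ^ Suc k) * r ^ k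
        = q * (case_nat p s k * (r * q) ^ k - (X + Y) * (s k * (r * q) ^ k))"
      by (simp add: power_mult_distrib algebra_simps)
  qed
  also have "r * suminf \<dots> = r * (q * (p + r * q * S (r * q) - (X + Y) * S (r * q)))"
    using summable_sums[OF s1] summable_sums[OF s2] unfolding head S_def
    by (intro arg_cong[of _ _ "(*) r"] sums_unique[symmetric] sums_mult sums_diff)
  finally have "S r = S (r * q) + r * (q * (p + r * q * S (r * q) - (X + Y) * S (r * q)))"
    by (simp add: algebra_simps)
  also have "\<dots> = (1 - r * X * q) * (1 - r * Y * q) * S (r * q) + p * q * r"
    using XY by algebra
  finally show ?thesis by (simp add: S_def)
qed

lemma three_term_series_summable_iterate:
  assumes "summable (\<lambda>k. s k * r ^ k)"
  shows "summable (\<lambda>k. s k * (r * q ^ n) ^ k)"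
proof (induction n)
  case (Suc n)
  have "r * q ^ n * q = r * q ^ Suc n" by simp
  thus ?case using powser_summable_mult_q[OF q Suc.IH] by (simp only:)
qed (use assms in simp)

text \<open>Iterating the \<open>q\<close>-difference equation \<open>n\<close> times leaves \<open>S (r q\<^sup>n)\<close>, which tends to \<open>s\<^sub>0\<close>, and a
  partial sum of the \<open>\<^sub>3\<phi>\<^sub>2\<close> series, in which the parameter \<open>q\<close> cancels the denominator \<open>(q)\<^sub>n\<close>.\<close>
lemma three_term_series_phi32:
  assumes "summable (\<lambda>k. s k * r ^ k)"
  shows "(\<Sum>k. s k * r ^ k) = qpoch_inf q (r * X * q) * qpoch_inf q (r * Y * q) * s 0
           + p * q * r * phi32 q (r * X * q) (r * Y * q) 0 0 q q"
proof -
  define S where "S x = (\<Sum>k. s k * x ^ k)" for x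
  define A where "A n = qpoch q (r * X * q) n * qpoch q (r * Y * q) n" for n
  have iter: "S r = A n * S (r * q ^ n) + (\<Sum>j<n. p * q * r * (A j * q ^ j))" for n
  proof (induction n)
    case (Suc n)
    have "S (r * q ^ n) = (1 - r * X * q * q ^ n) * (1 - r * Y * q * q ^ n) * S (r * q ^ Suc n)
            + p * q * (r * q ^ n)"
      using three_term_series_q_difference[OF three_term_series_summable_iterate[OF assms, of n]]
      by (simp add: S_def mult_ac)
    hence "A n * S (r * q ^ n) = A (Suc n) * S (r * q ^ Suc n) + p * q * r * (A n * q ^ n)"
      unfolding A_def qpoch_Suc by (simp only: distrib_left mult_ac)
    thus ?case using Suc.IH by simp
  qed (simp add: A_def)
  have "(\<lambda>n. S (r * q ^ n)) \<longlonglongrightarrow> s 0"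
    unfolding S_def by (rule powser_mult_q_tendsto[OF q assms])
  hence lim: "(\<lambda>n. A n * S (r * q ^ n)) \<longlonglongrightarrow> qpoch_inf q (r * X * q) * qpoch_inf q (r * Y * q) * s 0"
    unfolding A_def by (intro tendsto_mult qpoch_tendsto[OF q])
  have "summable (\<lambda>j. A j * q ^ j)"
  proof (cases "q = 0")
    case False
    have "Bseq A"
      unfolding A_def
      by (rule convergent_imp_Bseq) (blast intro: convergentI tendsto_mult qpoch_tendsto[OF q])
    then obtain K where K: "\<And>j. norm (A j) \<le> K" by (auto simp: Bseq_def)
    have "summable (\<lambda>j. K * norm q ^ j)" using q by (intro summable_mult summable_geometric) simp
    thus ?thesis
      by (rule summable_comparison_test[rotated])
        (use K in \<open>auto simp: norm_mult norm_power intro!: exI[of _ 0] mult_right_mono\<close>)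
  qed (auto intro!: summable_finite[of "{0}"])
  moreover have "phi32 q (r * X * q) (r * Y * q) 0 0 q q = (\<Sum>j. A j * q ^ j)"
    unfolding phi32_def A_def using qpoch_nonzero[OF q] by simp
  ultimately have "(\<lambda>n. \<Sum>j<n. A j * q ^ j) \<longlonglongrightarrow> phi32 q (r * X * q) (r * Y * q) 0 0 q q"
    using summable_LIMSEQ by fastforce
  hence "(\<lambda>n. A n * S (r * q ^ n) + (\<Sum>j<n. p * q * r * (A j * q ^ j)))
     \<longlonglongrightarrow> qpoch_inf q (r * X * q) * qpoch_inf q (r * Y * q) * s 0
           + p * q * r * phi32 q (r * X * q) (r * Y * q) 0 0 q q"
    unfolding sum_distrib_left[symmetric] by (intro tendsto_add lim tendsto_mult_left)
  hence "(\<lambda>n::nat. S r) \<longlonglongrightarrow> qpoch_inf q (r * X * q) * qpoch_inf q (r * Y * q) * s 0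
           + p * q * r * phi32 q (r * X * q) (r * Y * q) 0 0 q q"
    unfolding iter[symmetric] .
  thus ?thesis by (simp add: S_def LIMSEQ_const_iff)
qed

text \<open>The sequence \<open>t\<close> continues \<open>s\<close> to negative indices, \<open>t\<^sub>m = s\<^bsub>-m\<^esub>\<close>. There the recurrence is that of
  the Rogers-Szego polynomials, whence \<open>t\<^bsub>m+1\<^esub> = p H\<^sub>m(X, Y)\<close>. If \<open>P r\<close> is the infinite product and
  \<open>G r = \<Sum>\<^sub>m t\<^sub>m (q r)\<^sup>m / (q)\<^sub>m\<close>, their generating function \<open>1 / P\<close> shows that \<open>S / P\<close> and \<open>G\<close> have the
  same \<open>q\<close>-difference \<open>p q r / P r\<close>; as both tend to \<open>s\<^sub>0\<close> along the orbit of \<open>r\<close>, they agree.\<close>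
lemma three_term_series_product_form:
  assumes r: "summable (\<lambda>k. s k * r ^ k)"
    and X: "norm (r * X * q) < 1" and Y: "norm (r * Y * q) < 1"
    and t0: "t 0 = s 0" and t1: "t (Suc 0) = p" and t2: "t (Suc (Suc 0)) = (X + Y) * p"
    and t_rec: "\<And>m. t (m + 3) = (X + Y) * t (m + 2) - (1 - q ^ Suc m) * t (m + 1)"
  shows "(\<Sum>k. s k * r ^ k) = qpoch_inf q (r * X * q) * qpoch_inf q (r * Y * q) *
           (s 0 + p * q * r / (1 - q) * q_appell1 q 0 0 (q\<^sup>2) q (r * X * q) (r * Y * q))"
    and "(\<Sum>m. t m / qpoch q q m * q ^ m * r ^ m)
           = s 0 + p * q * r / (1 - q) * q_appell1 q 0 0 (q\<^sup>2) q (r * X * q) (r * Y * q)"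
proof -
  define P where "P x = qpoch_inf q (x * X * q) * qpoch_inf q (x * Y * q)" for x
  define S where "S x = (\<Sum>k. s k * x ^ k)" for x
  define c where "c m = t m / qpoch q q m * q ^ m" for m
  define G where "G x = (\<Sum>m. c m * x ^ m)" for x
  have q1: "1 - q \<noteq> 0" using one_minus_power_nonzero[OF q, of 0] by simp
  have tm: "t (Suc m) = p * (qpoch q q m * rs_coeff q X Y m)
      \<and> t (Suc (Suc m)) = p * (qpoch q q (Suc m) * rs_coeff q X Y (Suc m))" for m
  proof (induction m)
    case 0
    show ?case using t1 t2 rs_coeff_1[OF q, of X Y] by (simp add: qpoch_Suc)
  next
    case (Suc m)
    have "t (Suc (Suc (Suc m))) = (X + Y) * t (Suc (Suc m)) - (1 - q ^ Suc m) * t (Suc m)"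
      using t_rec[of m] by (simp add: numeral_3_eq_3)
    also have "\<dots> = p * (qpoch q q (Suc m) * ((1 - q ^ Suc (Suc m)) * rs_coeff q X Y (Suc (Suc m))))"
      unfolding rs_coeff_recurrence[OF q] XY Suc.IH[THEN conjunct1] Suc.IH[THEN conjunct2]
      by (simp add: qpoch_Suc algebra_simps)
    finally show ?case using Suc.IH by (simp add: qpoch_Suc mult_ac)
  qed
  have c_Suc: "c (Suc m) * (1 - q ^ Suc m) = p * q * (rs_coeff q X Y m * q ^ m)" for m
    unfolding c_def using tm[of m] qpoch_nonzero[OF q, of m] one_minus_power_nonzero[OF q, of m]
    by (simp add: qpoch_Suc)
  have disc: "norm ((r * q ^ n) * Z * q) < 1" if "norm (r * Z * q) < 1" for n Z
  proof -
    have "r * q ^ n * Z * q = r * Z * q * q ^ n" by simp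
    thus ?thesis using norm_mult_power_less_1[OF q that, of n] by (simp only:)
  qed
  have c_sums: "(\<lambda>m. c m * x ^ m) sums
      (s 0 + p * q * x / (1 - q) * q_appell1 q 0 0 (q\<^sup>2) q (x * X * q) (x * Y * q))"
    if "norm (x * X * q) < 1" "norm (x * Y * q) < 1" for x
  proof -
    have "(\<lambda>m. p * q * x / (1 - q) * ((1 - q) / (1 - q ^ Suc m) * (rs_coeff q X Y m * (x * q) ^ m)))
        sums (p * q * x / (1 - q) * q_appell1 q 0 0 (q\<^sup>2) q (x * X * q) (x * Y * q))"
      using q_appell1_sums[OF q, of "x * q" X Y] that by (intro sums_mult) (simp add: mult_ac)
    also have "(\<lambda>m. p * q * x / (1 - q) * ((1 - q) / (1 - q ^ Suc m) * (rs_coeff q X Y m * (x * q) ^ m)))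
        = (\<lambda>m. c (Suc m) * x ^ Suc m)"
    proof
      fix m
      have "c (Suc m) = p * q * (rs_coeff q X Y m * q ^ m) / (1 - q ^ Suc m)"
        using c_Suc[of m] one_minus_power_nonzero[OF q, of m] by (simp add: nonzero_eq_divide_eq)
      thus "p * q * x / (1 - q) * ((1 - q) / (1 - q ^ Suc m) * (rs_coeff q X Y m * (x * q) ^ m))
          = c (Suc m) * x ^ Suc m"
        using q1 by (simp add: power_mult_distrib)
    qed
    finally show ?thesis by (subst (asm) sums_Suc_iff) (simp add: c_def t0 add.commute)
  qed
  have G_step: "G x - G (x * q) = p * q * x / P x"
    if "norm (x * X * q) < 1" "norm (x * Y * q) < 1" for x
  proof -
    have "(\<lambda>N. rs_coeff q X Y N * (x * q) ^ N) sums (1 / P x)"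
      using rs_generating_function[OF q, of "x * q" X Y] that by (simp add: P_def mult_ac)
    hence "(\<lambda>N. p * q * (rs_coeff q X Y N * (x * q) ^ N)) sums (p * q * (1 / P x))"
      by (rule sums_mult)
    moreover have "(\<lambda>N. p * q * (rs_coeff q X Y N * (x * q) ^ N)) = (\<lambda>k. c (Suc k) * (1 - q ^ Suc k) * x ^ k)"
      unfolding c_Suc by (simp add: power_mult_distrib mult_ac)
    ultimately show ?thesis
      unfolding G_def powser_q_difference[OF q sums_summable[OF c_sums[OF that]]]
      by (simp add: sums_iff)
  qed
  have P_nz: "P (r * q ^ n) \<noteq> 0" for n
    unfolding P_def using disc[OF X, of n] disc[OF Y, of n] qpoch_inf_nonzero_disc[OF q] by simp
  have P_step: "P x = (1 - x * X * q) * (1 - x * Y * q) * P (x * q)" for x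
    unfolding P_def using qpoch_inf_step[OF q, of "x * X * q"] qpoch_inf_step[OF q, of "x * Y * q"]
    by (simp add: mult_ac)
  have S_step: "S (r * q ^ n) / P (r * q ^ n) - S (r * q ^ Suc n) / P (r * q ^ Suc n)
      = p * q * (r * q ^ n) / P (r * q ^ n)" for n
  proof -
    have 1: "S (r * q ^ n) = (1 - r * q ^ n * X * q) * (1 - r * q ^ n * Y * q) * S (r * q ^ Suc n)
            + p * q * (r * q ^ n)"
      using three_term_series_q_difference[OF three_term_series_summable_iterate[OF r, of n]]
      by (simp add: S_def mult_ac)
    have 2: "P (r * q ^ n) = (1 - r * q ^ n * X * q) * (1 - r * q ^ n * Y * q) * P (r * q ^ Suc n)"
      using P_step[of "r * q ^ n"] by (simp add: mult_ac)
    have "S (r * q ^ Suc n) / P (r * q ^ Suc n)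
        = (1 - r * q ^ n * X * q) * (1 - r * q ^ n * Y * q) * S (r * q ^ Suc n) / P (r * q ^ n)"
      using P_nz[of n] unfolding 2 by simp
    thus ?thesis unfolding 1 by (simp add: add_divide_distrib)
  qed
  have const: "S (r * q ^ n) / P (r * q ^ n) - G (r * q ^ n) = S r / P r - G r" for n
  proof (induction n)
    case (Suc n)
    have "G (r * q ^ n) - G (r * q ^ Suc n) = p * q * (r * q ^ n) / P (r * q ^ n)"
      using G_step[OF disc[OF X, of n] disc[OF Y, of n]] by (simp add: mult_ac)
    thus ?case using S_step[of n] Suc.IH by (simp add: algebra_simps)
  qed simp
  have "(\<lambda>n. P (r * q ^ n)) \<longlonglongrightarrow> 1 * 1"
    using qpoch_inf_tendsto_1[OF q, of "r * X * q"] qpoch_inf_tendsto_1[OF q, of "r * Y * q"]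
    unfolding P_def by (intro tendsto_mult) (simp_all add: mult_ac)
  moreover have "(\<lambda>n. G (r * q ^ n)) \<longlonglongrightarrow> c 0"
    unfolding G_def by (rule powser_mult_q_tendsto[OF q sums_summable[OF c_sums[OF X Y]]])
  moreover have "(\<lambda>n. S (r * q ^ n)) \<longlonglongrightarrow> s 0"
    unfolding S_def by (rule powser_mult_q_tendsto[OF q r])
  ultimately have "(\<lambda>n. S (r * q ^ n) / P (r * q ^ n) - G (r * q ^ n)) \<longlonglongrightarrow> s 0 / (1 * 1) - c 0"
    by (intro tendsto_intros) auto
  hence "S r / P r - G r = 0"
    unfolding const by (simp add: LIMSEQ_const_iff c_def t0)
  hence "S r = P r * G r" using P_nz[of 0] by (simp add: field_simps)
  moreover have G: "G r = s 0 + p * q * r / (1 - q) * q_appell1 q 0 0 (q\<^sup>2) q (r * X * q) (r * Y * q)"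
    using c_sums[OF X Y] by (simp add: G_def sums_iff)
  ultimately show "(\<Sum>k. s k * r ^ k) = qpoch_inf q (r * X * q) * qpoch_inf q (r * Y * q) *
           (s 0 + p * q * r / (1 - q) * q_appell1 q 0 0 (q\<^sup>2) q (r * X * q) (r * Y * q))"
    by (simp add: S_def P_def)
  show "(\<Sum>m. t m / qpoch q q m * q ^ m * r ^ m)
           = s 0 + p * q * r / (1 - q) * q_appell1 q 0 0 (q\<^sup>2) q (r * X * q) (r * Y * q)"
    using G by (simp add: G_def c_def)
qed

end

section \<open>The generalized \<open>\<mu>\<close>-function\<close>

lemma exp_2pi_eq_1_imp_int:
  assumes "exp (2 * of_real pi * \<i> * x) = 1"
  obtains n :: int where "x = of_int n"
proof -
  have "exp (2 * of_real pi * \<i> * x) = exp 0" using assms by simp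
  then obtain n :: int where "2 * of_real pi * \<i> * x = 0 + (of_int (2 * n) * pi) * \<i>"
    unfolding exp_eq by blast
  hence "2 * of_real pi * \<i> * x = 2 * of_real pi * \<i> * of_int n" by (simp add: mult_ac)
  hence "x = of_int n" by (subst (asm) mult_cancel_left) auto
  thus ?thesis by (rule that)
qed

lemma norm_qpow_1_less_1:
  assumes "Im \<tau> > 0"
  shows "norm (qpow \<tau> 1) < 1"
  using assms by (simp add: qpow_def)

lemma qpow_add: "qpow \<tau> (a + b) = qpow \<tau> a * qpow \<tau> b"
  by (simp add: qpow_def ring_distribs exp_add)

lemma qpow_nonzero [simp]: "qpow \<tau> a \<noteq> 0" and qpow_0 [simp]: "qpow \<tau> 0 = 1"
  by (simp_all add: qpow_def)

lemma qpow_of_int: "qpow \<tau> (of_int n) = qpow \<tau> 1 powi n"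
  by (simp add: qpow_def exp_power_int mult_ac)

lemma qpow_of_nat: "qpow \<tau> (of_nat n) = qpow \<tau> 1 ^ n"
  using qpow_of_int[of \<tau> "int n"] by simp

lemma exp_mult_qpow_neq_1:
  assumes "x \<notin> lattice \<tau>"
  shows "exp (2 * of_real pi * \<i> * x) * qpow \<tau> 1 powi n \<noteq> 1"
proof
  assume "exp (2 * of_real pi * \<i> * x) * qpow \<tau> 1 powi n = 1"
  hence "exp (2 * of_real pi * \<i> * (x + of_int n * \<tau>)) = 1"
    unfolding qpow_of_int[symmetric] unfolding qpow_def exp_add[symmetric] by (simp only: distrib_left mult.assoc)
  then obtain m :: int where "x + of_int n * \<tau> = of_int m" by (rule exp_2pi_eq_1_imp_int)
  hence "x = of_int m + of_int (- n) * \<tau>" by (simp add: algebra_simps)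
  thus False using assms unfolding lattice_def by blast
qed

lemma theta_term_exp:
  "(-1) powi n * exp (2 * of_real pi * \<i> * (of_int n + 1/2) * v) * qpow \<tau> (of_int n * (of_int n + 1) / 2)
     = exp (of_real pi * \<i> * v) * theta_term (qpow \<tau> 1) (exp (2 * of_real pi * \<i> * v)) n"
proof -
  have "even (n * (n + 1))" by simp
  hence "(of_int (n * (n + 1) div 2) :: complex) = of_int n * (of_int n + 1) / 2"
    by (simp add: of_int_div)
  hence "qpow \<tau> 1 powi (n * (n + 1) div 2) = qpow \<tau> (of_int n * (of_int n + 1) / 2)"
    by (metis qpow_of_int)
  moreover have "exp (2 * of_real pi * \<i> * (of_int n + 1/2) * v)
      = exp (of_real pi * \<i> * v) * exp (2 * of_real pi * \<i> * v) powi n"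
    by (simp add: exp_power_int ring_distribs exp_add[symmetric] mult_ac add_ac)
  ultimately show ?thesis by (simp add: theta_term_def mult_ac)
qed

lemma theta11_term:
  "exp (2 * of_real pi * \<i> * (of_int n + 1/2) * (v + 1/2) + of_real pi * \<i> * (of_int n + 1/2)\<^sup>2 * \<tau>)
     = \<i> * qpow \<tau> (1/8) * exp (of_real pi * \<i> * v)
         * theta_term (qpow \<tau> 1) (exp (2 * of_real pi * \<i> * v)) n"
proof -
  have sign: "exp (of_real pi * \<i> * of_int n) = (-1) powi n"
    using exp_power_int[of "of_real pi * \<i>" n] by (simp add: mult_ac)
  have half: "exp (of_real pi * \<i> / 2) = \<i>" using cis_pi_half by (simp add: cis_conv_exp mult_ac)
  have "2 * of_real pi * \<i> * (of_int n + 1/2) * (v + 1/2) + of_real pi * \<i> * (of_int n + 1/2)\<^sup>2 * \<tau>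
      = of_real pi * \<i> / 2 + 2 * of_real pi * \<i> * (1/8) * \<tau> + of_real pi * \<i> * of_int n
        + 2 * of_real pi * \<i> * (of_int n + 1/2) * v
        + 2 * of_real pi * \<i> * (of_int n * (of_int n + 1) / 2) * \<tau>"
    by (simp add: field_simps power2_eq_square)
  hence "exp (2 * of_real pi * \<i> * (of_int n + 1/2) * (v + 1/2) + of_real pi * \<i> * (of_int n + 1/2)\<^sup>2 * \<tau>)
      = \<i> * qpow \<tau> (1/8) * ((-1) powi n * exp (2 * of_real pi * \<i> * (of_int n + 1/2) * v)
          * qpow \<tau> (of_int n * (of_int n + 1) / 2))"
    by (simp only: exp_add sign half qpow_def) (simp only: mult.assoc)
  thus ?thesis unfolding theta_term_exp by (simp only: mult.assoc)
qed

lemma theta11_eq: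
  "theta11 \<tau> v = \<i> * qpow \<tau> (1/8) * exp (of_real pi * \<i> * v)
     * (\<Sum>\<^sub>\<infinity>n. theta_term (qpow \<tau> 1) (exp (2 * of_real pi * \<i> * v)) n)"
  unfolding theta11_def theta11_term by (rule infsum_cmult_right')

lemma theta11_nonzero:
  assumes "Im \<tau> > 0" "v \<notin> lattice \<tau>"
  shows "theta11 \<tau> v \<noteq> 0"
proof -
  have "exp (2 * of_real pi * \<i> * v) \<noteq> qpow \<tau> 1 powi n" for n :: int
    using exp_mult_qpow_neq_1[OF assms(2), of "- n"] by (auto simp: power_int_minus)
  thus ?thesis
    unfolding theta11_eq using theta_nonzero[OF norm_qpow_1_less_1[OF assms(1)]] by simp
qed

lemma gen_mu_eq_bilateral_sum:
  "gen_mu \<tau> u v \<alpha> = exp (of_real pi * \<i> * \<alpha> * (u - v)) / theta11 \<tau> v * (exp (of_real pi * \<i> * v)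
     * bilateral_sum (qpow \<tau> 1) (exp (2 * of_real pi * \<i> * v)) (exp (2 * of_real pi * \<i> * u)) (qpow \<tau> (- \<alpha>)))"
proof -
  have shift: "qpow \<tau> (of_int n + 1) = qpow \<tau> 1 powi (n + 1)" for n
    using qpow_of_int[of \<tau> "n + 1"] by simp
  have "of_int n - \<alpha> + 1 = - \<alpha> + (of_int n + 1)" for n by simp
  hence shift': "qpow \<tau> (of_int n - \<alpha> + 1) = qpow \<tau> (- \<alpha>) * qpow \<tau> 1 powi (n + 1)" for n
    by (simp only: qpow_add[of \<tau> "- \<alpha>"] shift)
  show ?thesis
    unfolding gen_mu_def bilateral_sum_def bilateral_term_def theta_term_exp shift shift'
      infsum_cmult_right'[symmetric] by (simp only: mult.assoc)
qed

text \<open>The contiguous relation in symmetric form: with \<open>X = e\<^bsup>\<pi>i(u-v)\<^esup>\<close> one has \<open>z = X\<^sup>2 w\<close>, and the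
  prefactor \<open>X\<^sup>\<alpha>\<close> of the \<open>\<mu>\<close>-function turns the coefficient \<open>1 + z/w\<close> into \<open>X + 1/X\<close>.\<close>
lemma gen_mu_recurrence:
  assumes "Im \<tau> > 0" "u - \<alpha> * \<tau> \<notin> lattice \<tau>"
  shows "(qpow \<tau> (1 - \<alpha>) - 1) * gen_mu \<tau> u v \<alpha> = gen_mu \<tau> u v (\<alpha> - 2)
    - (exp (of_real pi * \<i> * (u - v)) + exp (- (of_real pi * \<i> * (u - v)))) * gen_mu \<tau> u v (\<alpha> - 1)"
proof -
  define q where "q = qpow \<tau> 1"
  define z where "z = exp (2 * of_real pi * \<i> * u)"
  define w where "w = exp (2 * of_real pi * \<i> * v)"
  define X where "X = exp (of_real pi * \<i> * (u - v))"
  define e where "e = exp (of_real pi * \<i> * (\<alpha> - 2) * (u - v))"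
  define \<beta> where "\<beta> = qpow \<tau> (- \<alpha>)"
  define C where "C = exp (of_real pi * \<i> * v) / theta11 \<tau> v"
  define A where "A = bilateral_sum q w z"
  have "z * \<beta> = exp (2 * of_real pi * \<i> * (u - \<alpha> * \<tau>))"
    unfolding z_def \<beta>_def qpow_def exp_add[symmetric] by (simp add: algebra_simps)
  hence nz: "z * \<beta> * q powi n \<noteq> 1" for n :: int
    using exp_mult_qpow_neq_1[OF assms(2), of n] unfolding q_def by (simp only: not_False_eq_True)
  have q: "norm q < 1" unfolding q_def by (rule norm_qpow_1_less_1[OF assms(1)])
  have rec: "z * (\<beta> * q - 1) * A \<beta> = w * A (\<beta> * q\<^sup>2) - (w + z) * A (\<beta> * q)"
    unfolding A_def
    by (rule bilateral_sum_recurrence[OF q _ _ _ _ nz]) (simp_all add: q_def w_def z_def \<beta>_def)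
  have w: "w \<noteq> 0" and X: "X \<noteq> 0" by (simp_all add: w_def X_def)
  have z: "z = X * X * w"
    unfolding z_def w_def X_def by (simp add: exp_add[symmetric] algebra_simps)
  have "w * ((\<beta> * q - 1) * (X * X * A \<beta>)) = w * (A (\<beta> * q\<^sup>2) - (1 + X * X) * A (\<beta> * q))"
    using rec unfolding z by (simp add: algebra_simps)
  hence main: "(\<beta> * q - 1) * (X * X * A \<beta>) = A (\<beta> * q\<^sup>2) - (1 + X * X) * A (\<beta> * q)"
    using w by simp
  have \<beta>1: "qpow \<tau> (- (\<alpha> - 1)) = \<beta> * q" and \<beta>2: "qpow \<tau> (- (\<alpha> - 2)) = \<beta> * q\<^sup>2"
    and \<beta>q: "qpow \<tau> (1 - \<alpha>) = \<beta> * q"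
    unfolding \<beta>_def q_def power2_eq_square qpow_add[symmetric] by (simp_all add: algebra_simps)
  have e1: "exp (of_real pi * \<i> * (\<alpha> - 1) * (u - v)) = e * X"
    and e0: "exp (of_real pi * \<i> * \<alpha> * (u - v)) = e * (X * X)"
    unfolding e_def X_def exp_add[symmetric] by (simp_all add: algebra_simps)
  have mu0: "gen_mu \<tau> u v \<alpha> = e * C * (X * X * A \<beta>)"
    and mu1: "gen_mu \<tau> u v (\<alpha> - 1) = e * C * (X * A (\<beta> * q))"
    and mu2: "gen_mu \<tau> u v (\<alpha> - 2) = e * C * A (\<beta> * q\<^sup>2)"
    unfolding gen_mu_eq_bilateral_sum \<beta>1 \<beta>2 e1 e0 by (simp_all add: C_def A_def q_def w_def z_def e_def \<beta>_def)
  have Y: "exp (- (of_real pi * \<i> * (u - v))) = 1 / X" by (simp only: X_def exp_minus inverse_eq_divide)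
  have "(\<beta> * q - 1) * (e * C * (X * X * A \<beta>)) = e * C * (A (\<beta> * q\<^sup>2) - (1 + X * X) * A (\<beta> * q))"
    unfolding main[symmetric] by (simp only: mult_ac)
  also have "\<dots> = e * C * A (\<beta> * q\<^sup>2) - (X + 1 / X) * (e * C * (X * A (\<beta> * q)))"
    using X by (simp add: field_simps)
  finally show ?thesis
    unfolding mu0 mu1 mu2 \<beta>q Y X_def[symmetric] .
qed

lemma shift_notin_lattice:
  assumes "u \<notin> lattice \<tau>"
  shows "u - of_int a * \<tau> \<notin> lattice \<tau>"
proof
  assume "u - of_int a * \<tau> \<in> lattice \<tau>"
  then obtain m n :: int where "u - of_int a * \<tau> = of_int m + of_int n * \<tau>"
    by (auto simp: lattice_def)
  hence "u = of_int m + of_int (n + a) * \<tau>" by (simp add: algebra_simps)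
  thus False using assms unfolding lattice_def by blast
qed

text \<open>At \<open>\<alpha> = 0\<close> the quotient of infinite products is \<open>1\<close> and the series is \<open>\<theta>\<^sub>1\<^sub>1(v)\<close> itself up to a
  constant. This value produces the inhomogeneous term of the \<open>q\<close>-difference equation, and it is the place
  where \<open>\<theta>\<^sub>1\<^sub>1(v) \<noteq> 0\<close> matters.\<close>
lemma gen_mu_0:
  assumes "Im \<tau> > 0" "u \<notin> lattice \<tau>" "v \<notin> lattice \<tau>"
  shows "gen_mu \<tau> u v 0 = - \<i> * qpow \<tau> (- 1/8)"
proof -
  define z where "z = exp (2 * of_real pi * \<i> * u)"
  define T where "T = (\<Sum>\<^sub>\<infinity>n. theta_term (qpow \<tau> 1) (exp (2 * of_real pi * \<i> * v)) n)"
  have "qpoch_inf (qpow \<tau> 1) (z * qpow \<tau> 1 powi (n + 1)) \<noteq> 0" for n :: int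
  proof (rule qpoch_inf_nonzero[OF norm_qpow_1_less_1[OF assms(1)]])
    fix j
    show "z * qpow \<tau> 1 powi (n + 1) * qpow \<tau> 1 ^ j \<noteq> 1"
      using exp_mult_qpow_neq_1[OF assms(2), of "n + 1 + int j"] by (simp add: z_def power_int_add mult_ac)
  qed
  hence "bilateral_sum (qpow \<tau> 1) (exp (2 * of_real pi * \<i> * v)) z 1 = T"
    unfolding bilateral_sum_def bilateral_term_def T_def by simp
  hence "gen_mu \<tau> u v 0 = exp (of_real pi * \<i> * v) * T / theta11 \<tau> v"
    unfolding gen_mu_eq_bilateral_sum z_def by simp
  also have "exp (of_real pi * \<i> * v) * T = - \<i> * qpow \<tau> (- 1/8) * theta11 \<tau> v"
  proof -
    have "qpow \<tau> (- 1/8) * qpow \<tau> (1/8) = 1" by (simp flip: qpow_add)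
    hence "- \<i> * qpow \<tau> (- 1/8) * (\<i> * qpow \<tau> (1/8) * exp (of_real pi * \<i> * v) * T)
        = exp (of_real pi * \<i> * v) * T" by (simp add: mult_ac)
    thus ?thesis unfolding theta11_eq T_def by simp
  qed
  finally show ?thesis using theta11_nonzero[OF assms(1,3)] by simp
qed

theorem theorem1p7:
  fixes \<tau> q u v r X Y :: complex and S :: "complex \<Rightarrow> complex"
  assumes "Im \<tau> > 0"
    and q: "q = exp (2 * of_real pi * \<i> * \<tau>)"
    and "u \<notin> lattice \<tau>" and "v \<notin> lattice \<tau>"
    and S: "S = mu_series \<tau> u v"
    and X: "X = exp (of_real pi * \<i> * (u - v))"
    and Y: "Y = exp (- (of_real pi * \<i> * (u - v)))"
    and conv: "summable (mu_series_term \<tau> u v r)"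
  shows
    "S r = (1 - r * X * q) * (1 - r * Y * q) * S (r * q) - \<i> * r * qpow \<tau> (7/8)
     \<and>
     (1 - r * X * q\<^sup>2) * (1 - r * Y * q\<^sup>2) * (q_shift q ^^ 2) S r
       - (1 + q * (1 - r * X * q) * (1 - r * Y * q)) * q_shift q S r
       + q * S r = 0
     \<and>
     S r = qpoch_inf q (r * X * q) * qpoch_inf q (r * Y * q) * zwegers_mu \<tau> u v
       - \<i> * r * qpow \<tau> (7/8) * phi32 q (r * X * q) (r * Y * q) 0 0 q q
     \<and>
     (norm (r * X * q) < 1 \<and> norm (r * Y * q) < 1 \<longrightarrow>
       S r = qpoch_inf q (r * X * q) * qpoch_inf q (r * Y * q) *
         (zwegers_mu \<tau> u v
          - \<i> * r * qpow \<tau> (7/8) / (1 - q) * q_appell1 q 0 0 (q\<^sup>2) q (r * X * q) (r * Y * q))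
       \<and>
       S r = qpoch_inf q (r * X * q) * qpoch_inf q (r * Y * q) *
         (\<Sum>m. gen_mu \<tau> u v (1 - of_nat m) / qpoch q q m * q ^ m * r ^ m))"
proof -
  define s where "s k = gen_mu \<tau> u v (of_nat k + 1)" for k
  define t where "t m = gen_mu \<tau> u v (1 - of_nat m)" for m
  define p where "p = gen_mu \<tau> u v 0"
  have q1: "q = qpow \<tau> 1" by (simp add: q qpow_def)
  have nq: "norm q < 1" unfolding q1 by (rule norm_qpow_1_less_1[OF assms(1)])
  have XY: "X * Y = 1" by (simp add: X Y exp_minus)
  have rec_int: "(qpow \<tau> (1 - of_int a) - 1) * gen_mu \<tau> u v (of_int a)
      = gen_mu \<tau> u v (of_int a - 2) - (X + Y) * gen_mu \<tau> u v (of_int a - 1)" for a :: int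
    unfolding X Y by (rule gen_mu_recurrence[OF assms(1) shift_notin_lattice[OF assms(3)]])
  \<comment> \<open>The recurrence at \<open>\<alpha> = k + 2\<close>; the value \<open>p = \<mu>(u, v; 0)\<close> plays the part of \<open>s\<^bsub>-1\<^esub>\<close>.\<close>
  have rec: "(1 - q ^ Suc k) * s (Suc k) = q ^ Suc k * (case_nat p s k - (X + Y) * s k)" for k
  proof -
    have "gen_mu \<tau> u v (of_nat k) = case_nat p s k"
      by (cases k) (simp_all add: p_def s_def add.commute)
    hence "(qpow \<tau> (- of_nat (Suc k)) - 1) * s (Suc k) = case_nat p s k - (X + Y) * s k"
      using rec_int[of "int k + 2"] by (simp add: s_def algebra_simps)
    moreover have "q ^ Suc k * qpow \<tau> (- of_nat (Suc k)) = 1"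
      unfolding q1 qpow_of_nat[symmetric] by (simp del: of_nat_Suc flip: qpow_add)
    ultimately show ?thesis by (metis mult.assoc mult.commute mult.right_neutral right_diff_distrib)
  qed
  \<comment> \<open>The recurrence at \<open>\<alpha> = 1 - m\<close>. For \<open>m = 0\<close> the last coefficient vanishes, which
    decouples the values at \<open>\<alpha> \<le> 0\<close> from \<open>\<mu>(u, v; 1)\<close>.\<close>
  have t_rec: "t (m + 2) = (X + Y) * t (m + 1) + (q ^ m - 1) * t m" for m
    using rec_int[of "1 - int m"] by (simp add: t_def q1 qpow_of_nat algebra_simps)
  have pq: "p * q = - \<i> * qpow \<tau> (7/8)"
    unfolding p_def gen_mu_0[OF assms(1,3,4)] q1 by (simp flip: qpow_add)
  have S_eq: "S x = (\<Sum>k. s k * x ^ k)" for x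
    by (simp add: S mu_series_def mu_series_term_def s_def)
  have r: "summable (\<lambda>k. s k * r ^ k)" using conv by (simp add: mu_series_term_def[abs_def] s_def)
  have s0: "s 0 = zwegers_mu \<tau> u v" by (simp add: s_def)
  have step: "S x = (1 - x * X * q) * (1 - x * Y * q) * S (x * q) - \<i> * x * qpow \<tau> (7/8)"
    if "summable (\<lambda>k. s k * x ^ k)" for x
    using three_term_series_q_difference[OF nq XY rec that] by (simp add: S_eq pq mult_ac)
  have first: "S r = (1 - r * X * q) * (1 - r * Y * q) * S (r * q) - \<i> * r * qpow \<tau> (7/8)"
    by (rule step[OF r])
  \<comment> \<open>The homogeneous second-order equation: eliminate the inhomogeneous term between the first-order
    equations at \<open>r\<close> and at \<open>r q\<close>.\<close>
  have "S (r * q) = (1 - r * q * X * q) * (1 - r * q * Y * q) * S (r * q * q) - \<i> * (r * q) * qpow \<tau> (7/8)"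
    by (rule step[OF powser_summable_mult_q[OF nq r]])
  hence "(1 - r * X * q\<^sup>2) * (1 - r * Y * q\<^sup>2) * S (r * q * q) = S (r * q) + q * (\<i> * r * qpow \<tau> (7/8))"
    by (simp add: power2_eq_square mult_ac)
  hence second: "(1 - r * X * q\<^sup>2) * (1 - r * Y * q\<^sup>2) * S (r * q * q)
      - (1 + q * (1 - r * X * q) * (1 - r * Y * q)) * S (r * q) + q * S r = 0"
    unfolding first by (simp add: algebra_simps)
  have shift: "q_shift q S r = S (r * q)" "(q_shift q ^^ 2) S r = S (r * q * q)"
    by (simp_all add: q_shift_def numeral_2_eq_2 mult_ac)
  have third: "S r = qpoch_inf q (r * X * q) * qpoch_inf q (r * Y * q) * zwegers_mu \<tau> u v
       - \<i> * r * qpow \<tau> (7/8) * phi32 q (r * X * q) (r * Y * q) 0 0 q q"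
    using three_term_series_phi32[OF nq XY rec r] by (simp add: S_eq[of r] pq s0 mult_ac)
  have fourth: "S r = qpoch_inf q (r * X * q) * qpoch_inf q (r * Y * q) *
         (zwegers_mu \<tau> u v
          - \<i> * r * qpow \<tau> (7/8) / (1 - q) * q_appell1 q 0 0 (q\<^sup>2) q (r * X * q) (r * Y * q))
       \<and> S r = qpoch_inf q (r * X * q) * qpoch_inf q (r * Y * q) *
         (\<Sum>m. gen_mu \<tau> u v (1 - of_nat m) / qpoch q q m * q ^ m * r ^ m)"
    if "norm (r * X * q) < 1" "norm (r * Y * q) < 1"
  proof -
    have t0: "t 0 = s 0" and t1: "t (Suc 0) = p" and t2: "t (Suc (Suc 0)) = (X + Y) * p"
      using t_rec[of 0] by (simp_all add: t_def s_def p_def)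
    have t3: "t (m + 3) = (X + Y) * t (m + 2) - (1 - q ^ Suc m) * t (m + 1)" for m
      using t_rec[of "Suc m"] by (simp add: numeral_3_eq_3 algebra_simps)
    note P = three_term_series_product_form[OF nq XY rec r that t0 t1 t2 t3]
    have "p * q * r / (1 - q) = - (\<i> * r * qpow \<tau> (7/8) / (1 - q))"
      unfolding pq by simp
    hence "s 0 + p * q * r / (1 - q) * q_appell1 q 0 0 (q\<^sup>2) q (r * X * q) (r * Y * q)
      = zwegers_mu \<tau> u v - \<i> * r * qpow \<tau> (7/8) / (1 - q) * q_appell1 q 0 0 (q\<^sup>2) q (r * X * q) (r * Y * q)"
      by (simp only: s0) simp
    with P show ?thesis by (simp only: S_eq[of r] t_def)
  qed
  show ?thesis
    using first second third fourth unfolding shift by blast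
qed

end
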